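(* Let $F$ be a field of characteristic zero, $A\subseteq M_n(F)$ a semisimple subalgebra containing the identity, and $\mathcal G$ the group of units of the centralizer of $A$ in $M_n(F)$. Then every polynomial map $f:M_n(F)^k\to M_n(F)$ satisfying $f(gx_1g^{-1},\dots,gx_kg^{-1})=g\,f(x_1,\dots,x_k)\,g^{-1}$ for all $g\in\mathcal G$ is given by a mixed $A$-trace polynomial, i.e. by a linear combination of products $\phi\cdot a_1x_{i_1}a_2\cdots a_mx_{i_m}a_{m+1}$ where $a_j\in A$ and $\phi$ is a polynomial in functions $tr(b_1x_{j_1}\cdots b_rx_{j_r})$ with $b_l\in A$. *)

theory Defs
  imports "HOL-Analysis.Analysis"
begin

type_synonym ('a, 'n) mat = "'a ^ 'n ^ 'n"

text \<open>Scalar multiple of a matrix.\<close>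
definition msmult :: "'a::semiring_1 \<Rightarrow> ('a, 'n::finite) mat \<Rightarrow> ('a, 'n) mat" where
  "msmult c M = (\<chi> i j. c * M $ i $ j)"

text \<open>A unital subalgebra of M_n(F) (contains 1, closed under +, scalar multiples, products).\<close>
definition unital_subalgebra :: "('a::field, 'n::finite) mat set \<Rightarrow> bool" where
  "unital_subalgebra A \<longleftrightarrow> mat 1 \<in> A \<and> mat 0 \<in> A
     \<and> (\<forall>a\<in>A. \<forall>b\<in>A. a + b \<in> A \<and> a ** b \<in> A)
     \<and> (\<forall>c. \<forall>a\<in>A. msmult c a \<in> A)"

text \<open>Two-sided ideal of the subalgebra A.\<close>
definition alg_ideal :: "('a::field, 'n::finite) mat set \<Rightarrow> ('a, 'n) mat set \<Rightarrow> bool" where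
  "alg_ideal A I \<longleftrightarrow> I \<subseteq> A \<and> mat 0 \<in> I
     \<and> (\<forall>x\<in>I. \<forall>y\<in>I. x + y \<in> I)
     \<and> (\<forall>c. \<forall>x\<in>I. msmult c x \<in> I)
     \<and> (\<forall>a\<in>A. \<forall>x\<in>I. a ** x \<in> I \<and> x ** a \<in> I)"

text \<open>An ideal I is nilpotent if I^m = 0 for some m \<ge> 1, i.e. all products of m elements vanish.\<close>
definition nilpotent_ideal :: "('a::field, 'n::finite) mat set \<Rightarrow> bool" where
  "nilpotent_ideal I \<longleftrightarrow> (\<exists>m\<ge>1. \<forall>xs. length xs = m \<and> set xs \<subseteq> I \<longrightarrow>
      foldr (**) xs (mat 1) = mat 0)"

text \<open>Semisimple (finite-dimensional) algebra: no nonzero nilpotent ideal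
  (equivalently, zero Jacobson radical).\<close>
definition semisimple_subalgebra :: "('a::field, 'n::finite) mat set \<Rightarrow> bool" where
  "semisimple_subalgebra A \<longleftrightarrow> unital_subalgebra A \<and>
     (\<forall>I. alg_ideal A I \<and> nilpotent_ideal I \<longrightarrow> I = {mat 0})"

text \<open>Group of units of the centralizer of A in M_n(F).\<close>
definition centralizer_units :: "('a::field, 'n::finite) mat set \<Rightarrow> ('a, 'n) mat set" where
  "centralizer_units A = {g. invertible g \<and> (\<forall>a\<in>A. g ** a = a ** g)}"

text \<open>Polynomial functions of the k*n^2 coordinates of a tuple (x_1,...,x_k) of matrices.\<close>
inductive_set poly_funs :: "(('k \<Rightarrow> ('a::field, 'n::finite) mat) \<Rightarrow> 'a) set" where
  pf_const: "(\<lambda>X. c) \<in> poly_funs"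
| pf_coord: "(\<lambda>X. X i $ r $ s) \<in> poly_funs"
| pf_add: "p \<in> poly_funs \<Longrightarrow> q \<in> poly_funs \<Longrightarrow> (\<lambda>X. p X + q X) \<in> poly_funs"
| pf_mult: "p \<in> poly_funs \<Longrightarrow> q \<in> poly_funs \<Longrightarrow> (\<lambda>X. p X * q X) \<in> poly_funs"

text \<open>Polynomial map M_n(F)^k \<rightarrow> M_n(F): every entry is a polynomial in the coordinates.\<close>
definition polynomial_map :: "(('k \<Rightarrow> ('a::field, 'n::finite) mat) \<Rightarrow> ('a, 'n) mat) \<Rightarrow> bool" where
  "polynomial_map f \<longleftrightarrow> (\<forall>r s. (\<lambda>X. f X $ r $ s) \<in> poly_funs)"

text \<open>wordA [(b_1,j_1),...,(b_r,j_r)] X = b_1 x_{j_1} b_2 x_{j_2} ... b_r x_{j_r}.\<close>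
fun wordA :: "(('a::field, 'n::finite) mat \<times> 'k) list \<Rightarrow> ('k \<Rightarrow> ('a, 'n) mat) \<Rightarrow> ('a, 'n) mat" where
  "wordA [] X = mat 1"
| "wordA ((b, j) # ps) X = b ** X j ** wordA ps X"

text \<open>Polynomials in the functions tr(b_1 x_{j_1} ... b_r x_{j_r}), b_l \<in> A.\<close>
inductive_set trace_funs :: "('a::field, 'n::finite) mat set \<Rightarrow> (('k \<Rightarrow> ('a, 'n) mat) \<Rightarrow> 'a) set"
  for A where
  tf_const: "(\<lambda>X. c) \<in> trace_funs A"
| tf_trace: "set ps \<subseteq> A \<times> UNIV \<Longrightarrow> (\<lambda>X. trace (wordA ps X)) \<in> trace_funs A"
| tf_add: "p \<in> trace_funs A \<Longrightarrow> q \<in> trace_funs A \<Longrightarrow> (\<lambda>X. p X + q X) \<in> trace_funs A"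
| tf_mult: "p \<in> trace_funs A \<Longrightarrow> q \<in> trace_funs A \<Longrightarrow> (\<lambda>X. p X * q X) \<in> trace_funs A"

text \<open>Mixed A-trace polynomials: linear combinations of
  phi * a_1 x_{i_1} a_2 ... a_m x_{i_m} a_{m+1}.\<close>
inductive_set mixed_trace_polys :: "('a::field, 'n::finite) mat set \<Rightarrow>
    (('k \<Rightarrow> ('a, 'n) mat) \<Rightarrow> ('a, 'n) mat) set" for A where
  mtp_zero: "(\<lambda>X. mat 0) \<in> mixed_trace_polys A"
| mtp_term: "\<phi> \<in> trace_funs A \<Longrightarrow> set ps \<subseteq> A \<times> UNIV \<Longrightarrow> a \<in> A \<Longrightarrow>
    (\<lambda>X. msmult (\<phi> X) (wordA ps X ** a)) \<in> mixed_trace_polys A"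
| mtp_add: "f \<in> mixed_trace_polys A \<Longrightarrow> g \<in> mixed_trace_polys A \<Longrightarrow>
    (\<lambda>X. f X + g X) \<in> mixed_trace_polys A"

end

theory Submission
  imports Defs "HOL-Library.Function_Algebras" "HOL-Computational_Algebra.Polynomial"
begin

text \<open>Extracting homogeneous components and polarizing reduces the theorem to multilinear invariants
  \<^term>\<open>F\<close> of matrices, that is, to operators \<^term>\<open>T\<close> on a tensor power of \<open>V = F\<^sup>n\<close> that commute
  with \<open>g \<otimes> \<dots> \<otimes> g\<close> for all units \<^term>\<open>g\<close> of the centralizer \<open>C\<close> of \<^term>\<open>A\<close>. By density and
  polarization \<^term>\<open>T\<close> commutes with all symmetrized tensors of elements of \<open>C\<close>. A semisimple algebra
  in characteristic zero has a Casimir element \<open>\<Sum> b \<otimes> v b\<close> with \<open>\<Sum> b (v b) = 1\<close>; averaging with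
  its tensor power and with the symmetric group gives both a projection onto the symmetrized tensors
  over \<open>C\<close> and the double centralizer property: \<^term>\<open>T\<close> lies in the span of the operators
  \<open>(a\<^sub>1 \<otimes> \<dots> \<otimes> a\<^sub>m) \<sigma>\<close>. Pairing such an operator with a tensor of matrices yields one trace of a
  word per cycle of \<open>\<sigma>\<close>.\<close>

subsection \<open>Matrices as a vector space\<close>

text \<open>Pairing \<open>f X\<close> through \<open>trace\<close> with one further matrix
  \<open>Y\<close> turns the equivariant map into an invariant scalar function, and nondegeneracy of
  the trace pairing recovers \<open>f\<close> from it. The ground field is any field of
  characteristic zero, so the simple blocks of \<open>A\<close> may involve division algebras;
  working with a Casimir element avoids splitting \<open>A\<close> into blocks. Two of its
  properties carry the proof: the sum of all \<open>b ** M ** v b\<close> commutes with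
  \<open>A\<close> for every matrix \<open>M\<close>, and it is \<open>mat 1\<close> for
  \<open>M = mat 1\<close>. Its tensor power yields all tensors of elements of the centralizer,
  whereas the powers of a single unit span only symmetric ones. This gap forces the additional
  average over the symmetric group, and the permutations used there are the ones that reappear in
  the description of \<open>T\<close>. Characteristic zero enters in three ways: the trace of a
  nonzero idempotent is a nonzero dimension, factorials can be divided by, and the field is
  infinite, so that density and the comparison of homogeneous components work.\<close>

definition munit :: "'n \<Rightarrow> 'n \<Rightarrow> ('a::zero_neq_one, 'n::finite) mat" where
  "munit i j = (\<chi> p q. if p = i \<and> q = j then 1 else 0)"

lemma munit_nth [simp]: "munit i j $ p $ q = (if p = i \<and> q = j then 1 else 0)"
  by (simp add: munit_def)

lemma msmult_nth [simp]: "msmult c M $ i $ j = c * M $ i $ j"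
  by (simp add: msmult_def)

lemma mat_eq_iff: "M = N \<longleftrightarrow> (\<forall>i j. M $ i $ j = N $ i $ j)"
  by (simp add: vec_eq_iff)

lemma matrix_mult_nth: "(M ** N) $ i $ j = (\<Sum>k\<in>UNIV. M $ i $ k * N $ k $ j)"
  by (simp add: matrix_matrix_mult_def)

lemma matrix_mult_zero [simp]:
  "(M :: 'a::semiring_1^'n^'m) ** (0 :: 'a^'p^'n) = 0" "(0 :: 'a^'n^'m) ** (N :: 'a^'p^'n) = 0"
  by (simp_all add: vec_eq_iff matrix_mult_nth)

lemma msmult_mult [simp]:
  "msmult c M ** N = msmult c (M ** N)" "M ** msmult c N = msmult c (M ** N)"
  for c :: "'a::comm_semiring_1"
  by (simp_all add: mat_eq_iff matrix_mult_nth sum_distrib_left mult_ac)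

lemma matrix_add_rdistrib: "(A + B) ** C = A ** C + B ** C"
  by (simp add: vec_eq_iff matrix_mult_nth distrib_right sum.distrib)

lemma matrix_diff_ldistrib: "A ** (B - C) = A ** B - A ** C" for A :: "'a::ring_1^'n^'m"
  by (simp add: vec_eq_iff matrix_mult_nth right_diff_distrib sum_subtractf)

lemma matrix_diff_rdistrib: "(A - B) ** C = A ** C - B ** C" for A :: "'a::ring_1^'n^'m"
  by (simp add: vec_eq_iff matrix_mult_nth left_diff_distrib sum_subtractf)

lemma matrix_sum_ldistrib: "A ** (\<Sum>i\<in>I. F i) = (\<Sum>i\<in>I. A ** F i)"
  by (induction I rule: infinite_finite_induct) (simp_all add: matrix_add_ldistrib)

lemma matrix_sum_rdistrib: "(\<Sum>i\<in>I. F i) ** A = (\<Sum>i\<in>I. F i ** A)"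
  by (induction I rule: infinite_finite_induct) (simp_all add: matrix_add_rdistrib)

interpretation mat_vs: vector_space "msmult :: 'a::field \<Rightarrow> ('a, 'n::finite) mat \<Rightarrow> _"
  by unfold_locales (simp_all add: mat_eq_iff algebra_simps)

lemma mat_eq_sum_munit:
  "M = (\<Sum>(i, j)\<in>UNIV. msmult (M $ i $ j) (munit i j))"
  for M :: "('a::field, 'n::finite) mat"
proof -
  have "(\<Sum>(i, j)\<in>UNIV. msmult (M $ i $ j) (munit i j :: ('a, 'n) mat)) $ p $ q = M $ p $ q" for p q
  proof -
    have "(\<Sum>(i, j)\<in>UNIV. msmult (M $ i $ j) (munit i j :: ('a, 'n) mat)) $ p $ q
        = (\<Sum>z\<in>UNIV. if z = (p, q) then M $ p $ q else 0)"
      unfolding sum_component by (auto simp: case_prod_unfold prod_eq_iff intro!: sum.cong)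
    then show ?thesis by simp
  qed
  then show ?thesis by (simp add: mat_eq_iff)
qed

lemma inj_munit: "inj (\<lambda>(i, j). munit i j :: ('a::zero_neq_one, 'n::finite) mat)"
proof (rule injI, clarify)
  fix i j k l :: 'n
  assume "(munit i j :: ('a, 'n) mat) = munit k l"
  then have "(munit i j :: ('a, 'n) mat) $ i $ j = munit k l $ i $ j" by simp
  then show "i = k \<and> j = l" by (simp split: if_splits)
qed

lemma independent_munit:
  "mat_vs.independent (range (\<lambda>(i, j). munit i j :: ('a::field, 'n::finite) mat))"
proof (rule mat_vs.independent_if_scalars_zero)
  fix f :: "('a, 'n) mat \<Rightarrow> 'a" and x :: "('a, 'n) mat"
  assume s: "(\<Sum>x\<in>range (\<lambda>(i, j). munit i j). msmult (f x) x) = 0"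
    and "x \<in> range (\<lambda>(i, j). munit i j)"
  then obtain p q where x: "x = munit p q" by auto
  have "(\<Sum>x\<in>range (\<lambda>(i, j). munit i j). msmult (f x) x)
      = (\<Sum>(i, j)\<in>UNIV. msmult (f (munit i j)) (munit i j :: ('a, 'n) mat))"
    by (subst sum.reindex[OF inj_munit]) (simp add: case_prod_unfold)
  then have "0 = (\<Sum>(i, j)\<in>UNIV. msmult (f (munit i j)) (munit i j :: ('a, 'n) mat)) $ p $ q"
    using s by simp
  also have "\<dots> = (\<Sum>z\<in>UNIV. if z = (p, q) then f (munit p q) else 0)"
    unfolding sum_component by (auto simp: case_prod_unfold prod_eq_iff intro!: sum.cong)
  finally show "f x = 0" using x by simp
qed simp

lemma span_munit:
  "mat_vs.span (range (\<lambda>(i, j). munit i j :: ('a::field, 'n::finite) mat)) = UNIV"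
proof -
  have "M \<in> mat_vs.span (range (\<lambda>(i, j). munit i j))" for M :: "('a, 'n) mat"
    by (subst mat_eq_sum_munit, intro mat_vs.span_sum)
      (auto intro!: mat_vs.span_scale[OF mat_vs.span_base])
  then show ?thesis by auto
qed

interpretation mat_vs: finite_dimensional_vector_space
  "msmult :: 'a::field \<Rightarrow> ('a, 'n::finite) mat \<Rightarrow> _" "range (\<lambda>(i, j). munit i j)"
  by unfold_locales (simp_all add: independent_munit span_munit)

interpretation mat_vs_pair: finite_dimensional_vector_space_pair
  "msmult :: 'a::field \<Rightarrow> ('a, 'n::finite) mat \<Rightarrow> _" "range (\<lambda>(i, j). munit i j)"
  "msmult :: 'a::field \<Rightarrow> ('a, 'n::finite) mat \<Rightarrow> _" "range (\<lambda>(i, j). munit i j)"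
  by unfold_locales

lemma linear_left_mult:
  "Vector_Spaces.linear msmult msmult (\<lambda>x :: ('a::field, 'n::finite) mat. a ** x)"
  by unfold_locales (simp_all add: matrix_add_ldistrib)

lemma linear_right_mult:
  "Vector_Spaces.linear msmult msmult (\<lambda>x :: ('a::field, 'n::finite) mat. x ** a)"
  by unfold_locales (simp_all add: matrix_add_rdistrib)

subsection \<open>The Casimir element of a semisimple algebra\<close>

lemma subalgebra_subspace: "unital_subalgebra A \<Longrightarrow> mat_vs.subspace A"
  unfolding unital_subalgebra_def by (intro mat_vs.subspaceI) auto

lemma subalgebra_mult: "unital_subalgebra A \<Longrightarrow> a \<in> A \<Longrightarrow> b \<in> A \<Longrightarrow> a ** b \<in> A"
  and subalgebra_one: "unital_subalgebra A \<Longrightarrow> mat 1 \<in> A"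
  by (auto simp: unital_subalgebra_def)

text \<open>Between two occurrences of \<open>x\<close> in a product of elements of
  \<open>A x A\<close> there always stands an element of \<open>A\<close>, so this ideal has square
  zero. Semisimplicity makes it trivial, and it contains \<open>x\<close>.\<close>

lemma semisimple_semiprime:
  fixes A :: "('a::field, 'n::finite) mat set"
  assumes ss: "semisimple_subalgebra A" and x: "x \<in> A" and xx: "\<And>a. a \<in> A \<Longrightarrow> x ** a ** x = 0"
  shows "x = 0"
proof -
  have A: "unital_subalgebra A" using ss by (simp add: semisimple_subalgebra_def)
  define S where "S = {a ** x ** b | a b. a \<in> A \<and> b \<in> A}"
  let ?K = "mat_vs.span S"
  have S_mult: "p ** q = 0" if p: "p \<in> S" and q: "q \<in> S" for p q
  proof -
    obtain a b c d where eq: "p = a ** x ** b" "q = c ** x ** d" and mem: "b \<in> A" "c \<in> A"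
      using p q unfolding S_def by blast
    have "p ** q = a ** (x ** (b ** c) ** x) ** d" by (simp add: eq matrix_mul_assoc)
    then show ?thesis using xx[OF subalgebra_mult[OF A mem]] by simp
  qed
  have K_mult: "p ** q = 0" if "p \<in> ?K" "q \<in> ?K" for p q
  proof -
    have "p ** q = 0" if p: "p \<in> S" for p
      using \<open>q \<in> ?K\<close>
    proof (induction rule: mat_vs.span_induct)
      case (step q)
      then show ?case using S_mult[OF p] by blast
    qed (auto intro!: mat_vs.subspaceI simp: matrix_add_ldistrib)
    with \<open>p \<in> ?K\<close> show ?thesis
      by (induction rule: mat_vs.span_induct)
        (auto intro!: mat_vs.subspaceI simp: matrix_add_rdistrib)
  qed
  have "?K \<subseteq> A"
    using A x by (intro mat_vs.span_minimal subalgebra_subspace)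
      (auto simp: S_def unital_subalgebra_def)
  moreover have "a ** p \<in> ?K \<and> p ** a \<in> ?K" if a: "a \<in> A" and p: "p \<in> ?K" for a p
    using p
  proof (induction rule: mat_vs.span_induct)
    case base
    show ?case
    proof (rule mat_vs.subspaceI)
      fix y z assume "y \<in> {p. a ** p \<in> ?K \<and> p ** a \<in> ?K}" "z \<in> {p. a ** p \<in> ?K \<and> p ** a \<in> ?K}"
      then show "y + z \<in> {p. a ** p \<in> ?K \<and> p ** a \<in> ?K}"
        by (simp add: matrix_add_ldistrib matrix_add_rdistrib mat_vs.span_add)
    qed (simp_all add: mat_vs.span_zero mat_vs.span_scale)
  next
    case (step p)
    then obtain b c where "p = b ** x ** c" "b \<in> A" "c \<in> A" by (auto simp: S_def)
    then have "a ** p = (a ** b) ** x ** c" "p ** a = b ** x ** (c ** a)"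
      by (simp_all add: matrix_mul_assoc)
    with \<open>b \<in> A\<close> \<open>c \<in> A\<close> have "a ** p \<in> S" "p ** a \<in> S"
      using subalgebra_mult[OF A] a unfolding S_def by blast+
    then show ?case by (simp add: mat_vs.span_base)
  qed
  ultimately have "alg_ideal A ?K"
    by (auto simp: alg_ideal_def mat_vs.span_zero mat_vs.span_add mat_vs.span_scale)
  moreover have "nilpotent_ideal ?K"
    unfolding nilpotent_ideal_def
    by (rule exI[of _ 2]) (auto simp: numeral_2_eq_2 length_Suc_conv K_mult)
  ultimately have "?K = {0}" using ss by (simp add: semisimple_subalgebra_def)
  moreover have "x \<in> S"
    unfolding S_def using subalgebra_one[OF A] by (auto intro!: exI[of _ "mat 1"])
  ultimately show "x = 0" using mat_vs.span_base by blast
qed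

text \<open>Brauer's argument: a nonzero element \<^term>\<open>x\<close> of the ideal generating a left ideal of
  minimal dimension satisfies \<^term>\<open>x ** a ** x \<noteq> 0\<close> for some \<^term>\<open>a\<close>, and right
  multiplication by \<^term>\<open>a ** x\<close> is then bijective on that left ideal.\<close>

lemma ideal_has_idempotent:
  fixes A :: "('a::field, 'n::finite) mat set"
  assumes ss: "semisimple_subalgebra A" and I: "alg_ideal A I" "I \<noteq> {0}"
  obtains e where "e \<in> I" "e \<noteq> 0" "e ** e = e"
proof -
  have A: "unital_subalgebra A" using ss by (simp add: semisimple_subalgebra_def)
  have IA: "I \<subseteq> A" "0 \<in> I" "\<And>a x. a \<in> A \<Longrightarrow> x \<in> I \<Longrightarrow> a ** x \<in> I"
    using I(1) by (auto simp: alg_ideal_def)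
  define L where "L x = (\<lambda>a. a ** x) ` A" for x :: "('a, 'n) mat"
  have L_subspace: "mat_vs.subspace (L x)" for x
    unfolding L_def
    by (rule mat_vs_pair.linear_subspace_image[OF linear_right_mult subalgebra_subspace[OF A]])
  have L_self: "x \<in> L x" for x
    unfolding L_def using subalgebra_one[OF A] by (auto intro!: image_eqI[of _ _ "mat 1"])
  obtain y where "y \<in> I - {0}" using I(2) IA(2) by blast
  then obtain x where x: "x \<in> I" "x \<noteq> 0"
    and min: "\<And>y. y \<in> I \<Longrightarrow> y \<noteq> 0 \<Longrightarrow> mat_vs.dim (L x) \<le> mat_vs.dim (L y)"
    using ex_has_least_nat[of "\<lambda>y. y \<in> I - {0}" y "\<lambda>y. mat_vs.dim (L y)"] by auto
  have L_eq: "L y = L x" if y: "y \<in> L x" "y \<noteq> 0" for y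
  proof (rule mat_vs.subspace_dim_equal[OF L_subspace L_subspace])
    obtain a where a: "a \<in> A" "y = a ** x" using y by (auto simp: L_def)
    then show "L y \<subseteq> L x"
      using subalgebra_mult[OF A] by (auto simp: L_def matrix_mul_assoc)
    show "mat_vs.dim (L x) \<le> mat_vs.dim (L y)" using min a y IA(3) x(1) by blast
  qed
  obtain a where a: "a \<in> A" "x ** a ** x \<noteq> 0"
    using semisimple_semiprime[OF ss] x IA(1) by blast
  define y where "y = a ** x"
  have y: "y \<in> L x" using a by (auto simp: y_def L_def)
  have xy: "x ** y \<noteq> 0" using a by (simp add: y_def matrix_mul_assoc)
  have "x ** y \<in> L x"
    using subalgebra_mult[OF A, of x a] a(1) x(1) IA(1) by (auto simp: y_def L_def matrix_mul_assoc)
  then have "y \<in> L (x ** y)" using y L_eq xy by simp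
  then obtain b where b: "b \<in> A" "b ** x ** y = y" by (auto simp: L_def matrix_mul_assoc)
  \<comment> \<open>\<open>e\<close> is the preimage of \<open>y\<close> under right multiplication
    by \<open>y\<close> on \<open>L x\<close>. Hence \<open>e ** e - e\<close>, which also lies in
    \<open>L x\<close>, is annihilated by \<open>y\<close>, and injectivity makes \<open>e\<close>
    idempotent.\<close>
  define e where "e = b ** x"
  have ey: "e ** y = y" using b by (simp add: e_def)
  have inj: "l = 0" if l: "l \<in> L x" "l ** y = 0" for l
  proof (rule ccontr)
    assume "l \<noteq> 0"
    then have "x \<in> L l" using L_eq l L_self by blast
    then obtain c where "x = c ** l" by (auto simp: L_def)
    then have "x ** y = c ** (l ** y)" by (simp add: matrix_mul_assoc)
    then show False using l xy by simp
  qed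
  have "e \<in> A" using b x IA(1) subalgebra_mult[OF A] by (auto simp: e_def)
  have "e ** e \<in> L x" unfolding L_def e_def
    using b x IA(1) subalgebra_mult[OF A] \<open>e \<in> A\<close> by (auto simp: matrix_mul_assoc e_def)
  moreover have "e \<in> L x" using b by (auto simp: L_def e_def)
  moreover have "(e ** e - e) ** y = 0"
    by (simp add: matrix_diff_rdistrib ey flip: matrix_mul_assoc)
  ultimately have "e ** e - e = 0"
    using inj mat_vs.subspace_diff[OF L_subspace] by blast
  then have "e ** e = e" by simp
  moreover have "e \<noteq> 0" using ey xy by auto
  moreover have "e \<in> I" using b x IA by (simp add: e_def)
  ultimately show ?thesis using that by blast
qed

text \<open>Split \<open>e\<close> into the map from \<open>span B\<close> to \<open>span D\<close>
  followed by the inclusion. The trace is unchanged when the two factors are composed in the other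
  order, and that composite is the identity of \<open>span D\<close>. In coordinates this is one
  exchange of sums, and \<open>D\<close> need not be extended to a basis of
  \<open>span B\<close>.\<close>

lemma (in vector_space) trace_projection:
  assumes lin: "Vector_Spaces.linear scale scale e"
    and B: "finite B" "independent B" and D: "finite D" "independent D"
    and DB: "D \<subseteq> span B" and eB: "\<And>b. b \<in> B \<Longrightarrow> e b \<in> span D" and eD: "\<And>d. d \<in> D \<Longrightarrow> e d = d"
  shows "(\<Sum>b\<in>B. representation B (e b) b) = of_nat (card D)"
proof -
  interpret e: Vector_Spaces.linear scale scale e by fact
  let ?r = "representation D"
  have "representation B (e b) b = (\<Sum>d\<in>D. ?r (e b) d * representation B d b)" if b: "b \<in> B" for b
  proof -
    have "representation B (e b) = representation B (\<Sum>d\<in>D. scale (?r (e b) d) d)"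
      using sum_representation_eq[OF D(2) eB[OF b] D(1) order_refl] by simp
    also have "\<dots> = (\<lambda>b'. \<Sum>d\<in>D. ?r (e b) d * representation B d b')"
      using DB by (subst representation_sum[OF B(2)])
        (auto intro!: span_scale simp: representation_scale[OF B(2)] subset_iff)
    finally show ?thesis by simp
  qed
  then have "(\<Sum>b\<in>B. representation B (e b) b)
      = (\<Sum>d\<in>D. \<Sum>b\<in>B. representation B d b * ?r (e b) d)"
    by (simp add: mult.commute) (rule sum.swap)
  also have "\<dots> = (\<Sum>d\<in>D. ?r (e (\<Sum>b\<in>B. scale (representation B d b) b)) d)"
    by (simp add: e.sum e.scale representation_sum[OF D(2)] representation_scale[OF D(2)]
        span_scale eB)
  also have "\<dots> = (\<Sum>d\<in>D. ?r d d)"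
    using DB B D by (intro sum.cong refl) (simp add: sum_representation_eq subset_iff eD)
  also have "\<dots> = of_nat (card D)"
    by (simp add: representation_basis[OF D(2)])
  finally show ?thesis .
qed

text \<open>The pairs \<^term>\<open>(b, v b)\<close> are dual bases for the trace form of the regular representation, which is
  nondegenerate because its radical is an ideal without nonzero idempotents.\<close>

lemma semisimple_casimir:
  fixes A :: "('a::field_char_0, 'n::finite) mat set"
  assumes ss: "semisimple_subalgebra A"
  obtains B v where "finite B" "B \<subseteq> A" "v ` B \<subseteq> A" "(\<Sum>b\<in>B. b ** v b) = mat 1"
    "\<And>a M. a \<in> A \<Longrightarrow> (\<Sum>b\<in>B. a ** b ** M ** v b) = (\<Sum>b\<in>B. b ** M ** v b ** a)"
proof -
  have A: "unital_subalgebra A" using ss by (simp add: semisimple_subalgebra_def)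
  note sA = subalgebra_subspace[OF A] and mA = subalgebra_mult[OF A]
  obtain B where B: "B \<subseteq> A" "mat_vs.independent B" "A \<subseteq> mat_vs.span B"
    using mat_vs.maximal_independent_subset by blast
  have fB: "finite B" using B(2) mat_vs.finiteI_independent by blast
  have spB: "mat_vs.span B = A"
    using B mat_vs.span_minimal[OF B(1) sA] by blast
  let ?r = "mat_vs.representation B"
  have expand: "(\<Sum>b\<in>B. msmult (?r x b) b) = x" if "x \<in> A" for x
    using mat_vs.sum_representation_eq[OF B(2) _ fB order_refl] that spB by blast
  define t where "t x = (\<Sum>b\<in>B. ?r (x ** b) b)" for x
  have t_add: "t (x + y) = t x + t y" if "x \<in> A" "y \<in> A" for x y
  proof -
    have "x ** b \<in> mat_vs.span B" "y ** b \<in> mat_vs.span B" if "b \<in> B" for b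
      using that \<open>x \<in> A\<close> \<open>y \<in> A\<close> mA B(1) by (auto simp: spB)
    then show ?thesis
      by (simp add: t_def matrix_add_rdistrib mat_vs.representation_add[OF B(2)] sum.distrib)
  qed
  have t_scale: "t (msmult c x) = c * t x" if "x \<in> A" for c x
  proof -
    have "x ** b \<in> mat_vs.span B" if "b \<in> B" for b
      using that \<open>x \<in> A\<close> mA B(1) by (auto simp: spB)
    then show ?thesis
      by (simp add: t_def mat_vs.representation_scale[OF B(2)] sum_distrib_left)
  qed
  have t_0: "t 0 = 0" using t_scale[of 0 0] sA by (simp add: mat_vs.subspace_0)
  have t_sum: "t (\<Sum>i\<in>J. msmult (c i) (x i)) = (\<Sum>i\<in>J. c i * t (x i))"
    if "finite J" "\<And>i. i \<in> J \<Longrightarrow> x i \<in> A" for J :: "('a, 'n) mat set" and c x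
    using that
    by (induction J rule: finite_induct)
      (simp_all add: t_0 t_add t_scale mat_vs.subspace_scale[OF sA] mat_vs.subspace_sum[OF sA])
  have t_expand: "t (x ** y) = (\<Sum>c\<in>B. \<Sum>d\<in>B. ?r (y ** c) d * ?r (x ** d) c)"
    if "x \<in> A" "y \<in> A" for x y
  proof -
    have "?r (x ** y ** c) c = (\<Sum>d\<in>B. ?r (y ** c) d * ?r (x ** d) c)" if c: "c \<in> B" for c
    proof -
      have yc: "y ** c \<in> A" and xd: "x ** d \<in> mat_vs.span B" if "d \<in> B" for d
        using that c B(1) mA \<open>x \<in> A\<close> \<open>y \<in> A\<close> by (auto simp: spB)
      have "x ** y ** c = x ** (\<Sum>d\<in>B. msmult (?r (y ** c) d) d)"
        using expand[of "y ** c"] c mA \<open>y \<in> A\<close> B(1) by (simp add: matrix_mul_assoc subset_iff)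
      also have "\<dots> = (\<Sum>d\<in>B. msmult (?r (y ** c) d) (x ** d))"
        by (simp add: matrix_sum_ldistrib)
      finally show ?thesis
        by (simp add: mat_vs.representation_sum[OF B(2)] mat_vs.representation_scale[OF B(2)]
            mat_vs.span_scale xd)
    qed
    then show ?thesis by (simp add: t_def)
  qed
  have t_comm: "t (x ** y) = t (y ** x)" if "x \<in> A" "y \<in> A" for x y
    by (simp add: t_expand that) (subst sum.swap, simp add: mult.commute)
  define I where "I = {x \<in> A. \<forall>a\<in>A. t (x ** a) = 0}"
  have "alg_ideal A I"
    unfolding alg_ideal_def
  proof (intro conjI ballI allI)
    fix a x assume a: "a \<in> A" and x: "x \<in> I"
    have "t (a ** x ** c) = t (x ** (c ** a))" if "c \<in> A" for c
      using t_comm[of a "x ** c"] a x that mA by (simp add: I_def matrix_mul_assoc)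
    then show "a ** x \<in> I" using a x mA by (simp add: I_def)
    show "x ** a \<in> I" using a x mA by (simp add: I_def flip: matrix_mul_assoc)
  qed (auto simp: I_def t_0 t_add t_scale matrix_add_rdistrib mA
      mat_vs.subspace_0[OF sA] mat_vs.subspace_add[OF sA] mat_vs.subspace_scale[OF sA])
  have "I = {0}"
  proof (rule ccontr)
    assume "I \<noteq> {0}"
    then obtain e where e: "e \<in> I" "e \<noteq> 0" "e ** e = e"
      using ideal_has_idempotent[OF ss \<open>alg_ideal A I\<close>] by blast
    then have eA: "e \<in> A" by (simp add: I_def)
    let ?E = "(\<lambda>x. e ** x) ` A"
    obtain D where D: "D \<subseteq> ?E" "mat_vs.independent D" "?E \<subseteq> mat_vs.span D"
      using mat_vs.maximal_independent_subset by blast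
    have fD: "finite D" using D(2) mat_vs.finiteI_independent by blast
    have "D \<subseteq> A" using D(1) mA eA by blast
    \<comment> \<open>Left multiplication by the idempotent \<open>e\<close> projects
      \<open>A\<close> onto \<open>?E\<close>, so its trace is the dimension of \<open>?E\<close>.
      In characteristic zero this vanishes only if \<open>?E\<close> is zero, but \<open>e\<close>
      itself lies in \<open>?E\<close>.\<close>
    have "t e = of_nat (card D)"
      unfolding t_def
    proof (rule mat_vs.trace_projection[OF linear_left_mult fB B(2) fD D(2)])
      show "D \<subseteq> mat_vs.span B" using \<open>D \<subseteq> A\<close> spB by simp
      show "e ** b \<in> mat_vs.span D" if "b \<in> B" for b using that B(1) D(3) by blast
      show "e ** d = d" if "d \<in> D" for d
        using that D(1) e(3) by (auto simp: matrix_mul_assoc)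
    qed
    moreover have "t e = 0"
      using e(1) subalgebra_one[OF A] by (auto simp: I_def dest!: bspec[of _ _ "mat 1"])
    ultimately have "D = {}" using fD by simp
    then have "?E \<subseteq> {0}" using D(3) by simp
    moreover have "e \<in> ?E"
      using eA e(3) by (auto intro!: image_eqI[of _ _ e])
    ultimately show False using e(2) by blast
  qed
  then have nondeg: "x = 0" if "x \<in> A" "\<And>b. b \<in> B \<Longrightarrow> t (b ** x) = 0" for x
  proof -
    have "t (x ** a) = 0" if a: "a \<in> A" for a
    proof -
      have "t (x ** a) = t ((\<Sum>b\<in>B. msmult (?r a b) b) ** x)"
        using t_comm[OF \<open>x \<in> A\<close> a] expand[OF a] by simp
      also have "\<dots> = (\<Sum>b\<in>B. ?r a b * t (b ** x))"
        using \<open>x \<in> A\<close> B(1) mA by (simp add: matrix_sum_rdistrib t_sum[OF fB] subset_iff)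
      finally show ?thesis using \<open>\<And>b. b \<in> B \<Longrightarrow> t (b ** x) = 0\<close> by simp
    qed
    then have "x \<in> I" using \<open>x \<in> A\<close> by (simp add: I_def)
    then show "x = 0" using \<open>I = {0}\<close> by simp
  qed
  \<comment> \<open>The functional \<open>\<lambda>b. t (b ** x)\<close> is written in the basis
    \<open>B\<close> itself, so that it becomes an endomorphism of \<open>A\<close>. Nondegeneracy
    makes it injective, equality of dimensions makes it onto, and \<open>v b\<close> will be the
    preimage of \<open>b\<close>. Its linearity is of interest only on \<open>A\<close>, hence the
    linear map \<open>g\<close> below that agrees with it there.\<close>
  define \<phi> where "\<phi> x = (\<Sum>b\<in>B. msmult (if x \<in> A then t (b ** x) else 0) b)" for x
  have coeff: "c = d" if "(\<Sum>b\<in>B. msmult (f b) b) = (\<Sum>b\<in>B. msmult (g b) b)" "b \<in> B" "c = f b" "d = g b" 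
    for f g b c d
  proof -
    have "(\<Sum>b\<in>B. msmult (f b - g b) b) = 0"
      using that(1) by (simp add: mat_vs.scale_left_diff_distrib sum_subtractf)
    then show ?thesis
      using mat_vs.independentD[OF B(2) fB order_refl, of "\<lambda>b. f b - g b" b] that by simp
  qed
  obtain g where g: "Vector_Spaces.linear msmult msmult g" "\<And>x. x \<in> A \<Longrightarrow> g x = \<phi> x"
  proof -
    have "\<exists>g. Vector_Spaces.linear msmult msmult g \<and> (\<forall>x\<in>B. g x = \<phi> x)"
      using mat_vs_pair.linear_independent_extend[OF B(2)] by blast
    then obtain g where g: "Vector_Spaces.linear msmult msmult g" "\<And>x. x \<in> B \<Longrightarrow> g x = \<phi> x"
      by blast
    interpret g: Vector_Spaces.linear msmult msmult g by fact
    have "g x = \<phi> x" if x: "x \<in> A" for x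
    proof -
      have "t (c ** x) = (\<Sum>b\<in>B. ?r x b * t (c ** b))" if "c \<in> B" for c
      proof -
        have "t (c ** x) = t (c ** (\<Sum>b\<in>B. msmult (?r x b) b))" using expand[OF x] by simp
        also have "\<dots> = (\<Sum>b\<in>B. ?r x b * t (c ** b))"
          using that B(1) mA by (simp add: matrix_sum_ldistrib t_sum[OF fB] subset_iff)
        finally show ?thesis .
      qed
      then have "\<phi> x = (\<Sum>c\<in>B. \<Sum>b\<in>B. msmult (?r x b * t (c ** b)) c)"
        using x by (simp add: \<phi>_def mat_vs.scale_sum_left)
      also have "\<dots> = (\<Sum>b\<in>B. msmult (?r x b) (\<phi> b))"
        using B(1) by (subst sum.swap) (auto simp: \<phi>_def mat_vs.scale_sum_right intro!: sum.cong)
      also have "\<dots> = g (\<Sum>b\<in>B. msmult (?r x b) b)"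
        by (simp add: g.sum g.scale g)
      finally show ?thesis using expand[OF x] by simp
    qed
    then show ?thesis using that g by blast
  qed
  interpret g: Vector_Spaces.linear msmult msmult g by fact
  have span_A: "mat_vs.span A = A" using sA by simp
  have "inj_on g A"
  proof (rule inj_onI)
    fix x y assume xy: "x \<in> A" "y \<in> A" "g x = g y"
    then have d: "x - y \<in> A" using mat_vs.subspace_diff[OF sA] by blast
    have "\<phi> (x - y) = 0" using g(2)[OF d] xy by (simp add: g.diff)
    then have "t (b ** (x - y)) = 0" if "b \<in> B" for b
      using coeff[of "\<lambda>b. t (b ** (x - y))" "\<lambda>b. 0" b] that d by (simp add: \<phi>_def)
    then show "x = y" using nondeg[OF d] by simp
  qed
  then have "mat_vs.dim (g ` A) = mat_vs.dim A"
    by (intro mat_vs_pair.dim_image_eq) (simp_all add: span_A g.linear_axioms)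
  moreover have "g ` A \<subseteq> A"
    using B(1) by (auto simp: g(2) \<phi>_def intro!: mat_vs.subspace_sum[OF sA] mat_vs.subspace_scale[OF sA])
  moreover have "mat_vs.subspace (g ` A)"
    by (rule mat_vs_pair.linear_subspace_image[OF g(1) sA])
  ultimately have gA: "g ` A = A" using mat_vs.subspace_dim_equal sA by (metis order_refl)
  have "\<exists>v. \<forall>b\<in>B. v b \<in> A \<and> (\<forall>c\<in>B. t (c ** v b) = (if c = b then 1 else 0))"
  proof (rule bchoice, rule ballI)
    fix b assume b: "b \<in> B"
    then obtain x where x: "x \<in> A" "g x = b" using gA B(1) by (metis imageE subsetD)
    have "b = (\<Sum>c\<in>B. msmult (if c = b then 1 else 0) c)"
      using b fB by (simp add: if_distrib[of "\<lambda>s. msmult s _"] cong: if_cong)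
    moreover have "b = (\<Sum>c\<in>B. msmult (t (c ** x)) c)" using x g(2) by (simp add: \<phi>_def)
    ultimately have "\<forall>c\<in>B. t (c ** x) = (if c = b then 1 else 0)"
      using coeff[of "\<lambda>c. t (c ** x)" "\<lambda>c. if c = b then 1 else 0"] by simp
    then show "\<exists>x. x \<in> A \<and> (\<forall>c\<in>B. t (c ** x) = (if c = b then 1 else 0))" using x by blast
  qed
  then obtain v where vA: "\<And>b. b \<in> B \<Longrightarrow> v b \<in> A"
    and v: "\<And>b c. b \<in> B \<Longrightarrow> c \<in> B \<Longrightarrow> t (c ** v b) = (if c = b then 1 else 0)" by blast
  have exp1: "x = (\<Sum>b\<in>B. msmult (t (x ** v b)) b)" if x: "x \<in> A" for x
  proof -
    have "t (x ** v b) = ?r x b" if b: "b \<in> B" for b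
    proof -
      have "t (x ** v b) = t (\<Sum>c\<in>B. msmult (?r x c) (c ** v b))"
        using expand[OF x] by (simp flip: msmult_mult matrix_sum_rdistrib)
      also have "\<dots> = (\<Sum>c\<in>B. ?r x c * t (c ** v b))"
        using b vA B(1) mA by (intro t_sum[OF fB]) blast
      also have "\<dots> = ?r x b" using b fB by (simp add: v if_distrib[of "\<lambda>s. _ * s"] cong: if_cong)
      finally show ?thesis .
    qed
    then show ?thesis using expand[OF x] by simp
  qed
  have exp2: "x = (\<Sum>b\<in>B. msmult (t (b ** x)) (v b))" if x: "x \<in> A" for x
  proof -
    let ?y = "\<Sum>b\<in>B. msmult (t (b ** x)) (v b)"
    have y: "?y \<in> A" using vA by (intro mat_vs.subspace_sum[OF sA] mat_vs.subspace_scale[OF sA])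
    have "t (c ** (x - ?y)) = 0" if c: "c \<in> B" for c
    proof -
      have cA: "c \<in> A" using c B(1) by blast
      have "t (c ** ?y) = (\<Sum>b\<in>B. t (b ** x) * t (c ** v b))"
        using cA vA mA by (simp add: matrix_sum_ldistrib t_sum[OF fB])
      also have "\<dots> = t (c ** x)"
        using c fB by (simp add: v if_distrib[of "\<lambda>s. _ * s"] cong: if_cong)
      finally have "t (c ** ?y) = t (c ** x)" .
      moreover have "t (c ** x) = t (c ** (x - ?y)) + t (c ** ?y)"
        using t_add[of "c ** (x - ?y)" "c ** ?y"] cA x y mA mat_vs.subspace_diff[OF sA x y]
        by (simp add: matrix_add_ldistrib[symmetric])
      ultimately show ?thesis by simp
    qed
    then have "x - ?y = 0" by (intro nondeg mat_vs.subspace_diff[OF sA x y])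
    then show ?thesis by simp
  qed
  show ?thesis
  proof (rule that[of B v])
    show "v ` B \<subseteq> A" using vA by blast
    let ?z = "\<Sum>b\<in>B. b ** v b"
    have zA: "?z \<in> A" using B(1) vA mA by (intro mat_vs.subspace_sum[OF sA]) blast
    \<comment> \<open>By duality \<open>t (a ** b ** v b)\<close> is the coefficient of
      \<open>b\<close> in \<open>a ** b\<close>. Summed over \<open>b\<close> it gives the trace of
      left multiplication by \<open>a\<close>, that is \<open>t a\<close>. This is why the regular
      trace form produces \<open>mat 1\<close> without any rescaling.\<close>
    have "t (a ** (?z - mat 1)) = 0" if a: "a \<in> B" for a
    proof -
      have aA: "a \<in> A" using a B(1) by blast
      have "t (a ** ?z) = (\<Sum>b\<in>B. t (a ** b ** v b))"
        using aA vA mA B(1) t_sum[OF fB, of "\<lambda>b. a ** b ** v b" "\<lambda>_. 1"]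
        by (simp add: matrix_sum_ldistrib matrix_mul_assoc subset_iff)
      also have "\<dots> = t a"
      proof -
        have "t (a ** b ** v b) = ?r (a ** b) b" if b: "b \<in> B" for b
        proof -
          have ab: "a ** b \<in> A" using aA b B(1) mA by blast
          show ?thesis
            using coeff[of "\<lambda>c. t (a ** b ** v c)" "?r (a ** b)" b] exp1[OF ab] expand[OF ab] b
            by simp
        qed
        then show ?thesis by (simp add: t_def)
      qed
      finally have "t (a ** ?z) = t a" .
      moreover have "t (a ** ?z) = t (a ** (?z - mat 1)) + t (a ** mat 1)"
        using t_add[of "a ** (?z - mat 1)" "a ** mat 1"] aA zA mA
          mat_vs.subspace_diff[OF sA _ aA, of "a ** ?z"]
        by (simp add: matrix_diff_ldistrib)
      ultimately show ?thesis by simp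
    qed
    then have "?z - mat 1 = 0"
      by (intro nondeg mat_vs.subspace_diff[OF sA zA subalgebra_one[OF A]])
    then show "?z = mat 1" by simp
    fix a M :: "('a, 'n) mat" assume a: "a \<in> A"
    have aB: "a ** b \<in> A" and va: "v b ** a \<in> A" if "b \<in> B" for b
      using that a B(1) vA mA by auto
    \<comment> \<open>The number \<open>t (a ** b ** v c)\<close> is at once the coefficient of
      \<open>c\<close> in \<open>a ** b\<close> and, by symmetry of the form, the coefficient of
      \<open>v b\<close> in \<open>v c ** a\<close>. Expanding by \<open>exp1\<close> and collecting
      by \<open>exp2\<close> therefore carries \<open>a\<close> from one end to the other.\<close>
    have "(\<Sum>b\<in>B. a ** b ** M ** v b)
        = (\<Sum>b\<in>B. (\<Sum>c\<in>B. msmult (t (a ** b ** v c)) c) ** M ** v b)"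
      using exp1[OF aB] by simp
    also have "\<dots> = (\<Sum>c\<in>B. c ** M ** (\<Sum>b\<in>B. msmult (t (a ** b ** v c)) (v b)))"
      by (simp add: matrix_sum_rdistrib matrix_sum_ldistrib) (rule sum.swap)
    also have "\<dots> = (\<Sum>c\<in>B. c ** M ** (v c ** a))"
    proof (intro sum.cong refl)
      fix c assume c: "c \<in> B"
      have "t (a ** b ** v c) = t (b ** (v c ** a))" if "b \<in> B" for b
        using t_comm[of a "b ** v c"] a that c B(1) vA mA by (simp add: matrix_mul_assoc subset_iff)
      then show "c ** M ** (\<Sum>b\<in>B. msmult (t (a ** b ** v c)) (v b)) = c ** M ** (v c ** a)"
        using exp2[OF va[OF c]] by simp
    qed
    finally show "(\<Sum>b\<in>B. a ** b ** M ** v b) = (\<Sum>b\<in>B. b ** M ** v b ** a)"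
      by (simp add: matrix_mul_assoc)
  qed (use fB B in auto)
qed

subsection \<open>Polarization and contractions\<close>

text \<open>Expanding the product on the right gives a sum over all maps from \<open>I\<close> to
  \<open>S\<close>. Inclusion-exclusion over \<open>S\<close> leaves only the maps with image
  \<open>I\<close>, which for finite \<open>I\<close> are the permutations.\<close>

lemma permanent_polarization:
  fixes a :: "'i \<Rightarrow> 'i \<Rightarrow> 'a::comm_ring_1"
  assumes I: "finite I"
  shows "(\<Sum>\<sigma> | \<sigma> permutes I. \<Prod>i\<in>I. a i (\<sigma> i))
    = (\<Sum>S\<in>Pow I. (-1) ^ (card I - card S) * (\<Prod>i\<in>I. \<Sum>j\<in>S. a i j))"
proof -
  define f where "f U = (\<Sum>\<phi> | \<phi> \<in> extensional I \<and> \<phi> ` I = U. \<Prod>i\<in>I. a i (\<phi> i))" for U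
  have "(\<Prod>i\<in>I. \<Sum>j\<in>S. a i j) = sum f (Pow S)" if S: "finite S" for S
  proof -
    have "(\<Prod>i\<in>I. \<Sum>j\<in>S. a i j) = (\<Sum>\<phi>\<in>I \<rightarrow>\<^sub>E S. \<Prod>i\<in>I. a i (\<phi> i))"
      using S by (intro prod_sum_PiE[OF I])
    also have "\<dots> = (\<Sum>U\<in>Pow S. \<Sum>\<phi> | \<phi> \<in> (I \<rightarrow>\<^sub>E S) \<and> \<phi> ` I = U. \<Prod>i\<in>I. a i (\<phi> i))"
      by (rule sum.group[symmetric]) (use S I in \<open>auto intro!: finite_PiE\<close>)
    also have "\<dots> = sum f (Pow S)"
      unfolding f_def by (intro sum.cong refl arg_cong2[of _ _ _ _ sum]) (auto simp: PiE_def)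
    finally show ?thesis .
  qed
  then have "f I = (\<Sum>S\<in>Pow I. (-1) ^ (card I - card S) * (\<Prod>i\<in>I. \<Sum>j\<in>S. a i j))"
    using I by (rule inclusion_exclusion_mobius)
  \<comment> \<open>A self-map of the finite set \<open>I\<close> with image \<open>I\<close> is
    bijective. The two witnesses only translate between maps undefined outside \<open>I\<close> and
    permutations, which are the identity there.\<close>
  moreover have "f I = (\<Sum>\<sigma> | \<sigma> permutes I. \<Prod>i\<in>I. a i (\<sigma> i))"
    unfolding f_def
  proof (rule sum.reindex_bij_witness[of _ "\<lambda>\<sigma>. restrict \<sigma> I" "\<lambda>\<phi> x. if x \<in> I then \<phi> x else x"])
    fix \<phi> assume \<phi>: "\<phi> \<in> {\<phi>. \<phi> \<in> extensional I \<and> \<phi> ` I = I}"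
    then show "restrict (\<lambda>x. if x \<in> I then \<phi> x else x) I = \<phi>"
      by (auto simp: fun_eq_iff extensional_def)
    have "inj_on \<phi> I" using \<phi> I by (intro eq_card_imp_inj_on) auto
    then have "bij_betw \<phi> I I" using \<phi> by (auto simp: bij_betw_def)
    then show "(\<lambda>x. if x \<in> I then \<phi> x else x) \<in> {\<sigma>. \<sigma> permutes I}"
      by (auto simp: permutes_altdef cong: bij_betw_cong)
  qed (auto simp: permutes_image image_restrict_eq fun_eq_iff permutes_not_in permutes_in_image)
  ultimately show ?thesis by simp
qed

section \<open>Contractions of a family of matrices along a permutation\<close>

lemma sum_PiE_insert:
  fixes F :: "('i \<Rightarrow> 'n) \<Rightarrow> 'a::comm_monoid_add"
  assumes "i \<notin> I"
  shows "(\<Sum>x\<in>insert i I \<rightarrow>\<^sub>E S. F x) = (\<Sum>x\<in>I \<rightarrow>\<^sub>E S. \<Sum>y\<in>S. F (x(i := y)))"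
proof -
  have "(\<Sum>x\<in>insert i I \<rightarrow>\<^sub>E S. F x) = (\<Sum>(x, y)\<in>(I \<rightarrow>\<^sub>E S) \<times> S. F (x(i := y)))"
    using assms
    by (intro sum.reindex_bij_witness[of _ "\<lambda>(x, y). x(i := y)" "\<lambda>x. (x(i := undefined), x i)"])
      (auto simp: PiE_def extensional_def)
  then show ?thesis by (simp add: sum.cartesian_product)
qed

text \<open>This is the trace, on the tensor power indexed by \<open>I\<close>, of the tensor
  product of the \<open>M i\<close> composed with the permutation of factors given by
  \<open>\<sigma>\<close>. It equals the product over the cycles of \<open>\<sigma>\<close> of the
  traces of the matrix products along the cycles. In place of a cycle decomposition, the lemmas
  below remove one index at a time.\<close>

definition contraction ::
  "'i set \<Rightarrow> ('i \<Rightarrow> ('a::comm_ring_1, 'n::finite) mat) \<Rightarrow> ('i \<Rightarrow> 'i) \<Rightarrow> 'a" where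
  "contraction I M \<sigma> = (\<Sum>x\<in>I \<rightarrow>\<^sub>E UNIV. \<Prod>i\<in>I. M i $ x i $ x (\<sigma> i))"

lemma contraction_cong:
  "(\<And>i. i \<in> I \<Longrightarrow> M i = N i) \<Longrightarrow> (\<And>i. i \<in> I \<Longrightarrow> \<sigma> i = \<tau> i) \<Longrightarrow> contraction I M \<sigma> = contraction I N \<tau>"
  by (simp add: contraction_def)

lemma contraction_insert_fixed:
  assumes "finite I" "i \<notin> I" "\<sigma> permutes I"
  shows "contraction (insert i I) M \<sigma> = trace (M i) * contraction I M \<sigma>"
proof -
  have "\<sigma> i = i" using assms by (simp add: permutes_not_in)
  moreover have "(\<Prod>j\<in>I. M j $ (x(i := y)) j $ (x(i := y)) (\<sigma> j)) = (\<Prod>j\<in>I. M j $ x j $ x (\<sigma> j))"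
    for x y
    using assms permutes_in_image[OF assms(3)] by (intro prod.cong refl) auto
  ultimately have "contraction (insert i I) M \<sigma>
      = (\<Sum>x\<in>I \<rightarrow>\<^sub>E UNIV. \<Sum>y\<in>UNIV. M i $ y $ y * (\<Prod>j\<in>I. M j $ x j $ x (\<sigma> j)))"
    using assms by (simp add: contraction_def sum_PiE_insert)
  then show ?thesis
    by (simp add: contraction_def trace_def sum_distrib_left sum_distrib_right)
qed

text \<open>The summation variable \<open>x i\<close> occurs only in the factors of \<open>l\<close>
  and of \<open>i\<close>, so summing over it multiplies these two matrices. Composing with the
  transposition cuts \<open>i\<close> out of its cycle: \<open>l\<close> is now sent to
  \<open>\<sigma> i\<close>, and \<open>i\<close> is fixed.\<close>

lemma contraction_insert_merge:
  assumes I: "finite I" "i \<notin> I" and \<sigma>: "\<sigma> permutes insert i I" and l: "l \<in> I" "\<sigma> l = i"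
  shows "contraction (insert i I) M \<sigma>
    = contraction I (M(l := M l ** M i)) (Transposition.transpose i (\<sigma> i) \<circ> \<sigma>)"
proof -
  let ?\<tau> = "Transposition.transpose i (\<sigma> i) \<circ> \<sigma>"
  note inj = permutes_inj[OF \<sigma>, THEN injD]
  have \<sigma>i: "\<sigma> i \<noteq> i" using inj[of i l] l I by auto
  have \<tau>: "?\<tau> j = \<sigma> j" "\<sigma> j \<noteq> i" if "j \<in> I - {l}" for j
    using that inj[of j l] inj[of j i] l I by (auto simp: Transposition.transpose_def)
  have \<tau>l: "?\<tau> l = \<sigma> i" using l by simp
  have "(\<Sum>y\<in>UNIV. \<Prod>j\<in>insert i I. M j $ (x(i := y)) j $ (x(i := y)) (\<sigma> j))
      = (\<Prod>j\<in>I. (M(l := M l ** M i)) j $ x j $ x (?\<tau> j))" for x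
  proof -
    have "(\<Prod>j\<in>insert i I. M j $ (x(i := y)) j $ (x(i := y)) (\<sigma> j))
        = M l $ x l $ y * M i $ y $ x (\<sigma> i) * (\<Prod>j\<in>I - {l}. M j $ x j $ x (?\<tau> j))" for y
    proof -
      have "(\<Prod>j\<in>I. M j $ (x(i := y)) j $ (x(i := y)) (\<sigma> j))
          = M l $ x l $ y * (\<Prod>j\<in>I - {l}. M j $ (x(i := y)) j $ (x(i := y)) (\<sigma> j))"
        using I l by (subst prod.remove[of _ l]) auto
      also have "(\<Prod>j\<in>I - {l}. M j $ (x(i := y)) j $ (x(i := y)) (\<sigma> j))
          = (\<Prod>j\<in>I - {l}. M j $ x j $ x (?\<tau> j))"
        using \<tau> I by (intro prod.cong refl) auto
      finally show ?thesis using I \<sigma>i by (simp add: mult_ac)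
    qed
    moreover have "(\<Prod>j\<in>I. (M(l := M l ** M i)) j $ x j $ x (?\<tau> j))
        = (M l ** M i) $ x l $ x (\<sigma> i) * (\<Prod>j\<in>I - {l}. M j $ x j $ x (?\<tau> j))"
      using I l \<tau>l by (subst prod.remove[of _ l]) auto
    ultimately show ?thesis by (simp add: matrix_mult_nth sum_distrib_right)
  qed
  then show ?thesis
    using I by (simp add: contraction_def sum_PiE_insert)
qed

lemma wordA_append: "wordA (ps @ qs) X = wordA ps X ** wordA qs X"
  by (induction ps) (auto simp: matrix_mul_assoc)

text \<open>Induction removes the indices other than \<open>d\<close>. A fixed index closes its word
  into a trace; any other index hands its word to its predecessor \<open>l\<close> in the cycle. If
  the predecessor is \<open>d\<close>, the word is absorbed into \<open>Z\<close>, which is why the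
  identity is claimed for all \<open>Z\<close>. The index \<open>d\<close> is never removed, so the
  remaining cycle is the one through \<open>Z\<close>.\<close>

lemma contraction_words:
  fixes A :: "('a::field, 'n::finite) mat set" and ps :: "'i \<Rightarrow> (('a, 'n) mat \<times> 'k) list"
  assumes "finite I" "d \<notin> I" "\<sigma> permutes insert d I" "\<And>i. i \<in> I \<Longrightarrow> set (ps i) \<subseteq> A \<times> UNIV"
  shows "\<exists>t\<in>trace_funs A. \<exists>qs. set qs \<subseteq> A \<times> UNIV \<and>
    (\<forall>X Z. contraction (insert d I) (\<lambda>i. if i = d then Z else wordA (ps i) X) \<sigma>
      = t X * trace (Z ** wordA qs X))"
  using assms
proof (induction I arbitrary: \<sigma> ps rule: finite_induct)
  case empty
  have "contraction {d} (\<lambda>i. if i = d then Z else wordA (ps i) X) \<sigma> = 1 * trace (Z ** wordA [] X)"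
    for X Z
  proof -
    have "\<sigma> d = d" using empty by simp
    then have "contraction {d} (\<lambda>i. if i = d then Z else wordA (ps i) X) \<sigma>
        = contraction {d} (\<lambda>i. if i = d then Z else wordA (ps i) X) id"
      by (intro contraction_cong) auto
    also have "\<dots> = trace Z * contraction {} (\<lambda>i. if i = d then Z else wordA (ps i) X) id"
      by (subst contraction_insert_fixed) auto
    finally show ?thesis by (simp add: contraction_def)
  qed
  then show ?case
    by (intro bexI[of _ "\<lambda>X. 1"] exI[of _ "[]"]) (auto intro: trace_funs.intros)
next
  case (insert i I)
  let ?J = "insert d I"
  have i: "i \<notin> ?J" "finite ?J" "insert d (insert i I) = insert i ?J" "i \<noteq> d"
    using insert by auto
  have \<sigma>: "\<sigma> permutes insert i ?J" using insert.prems i by simp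
  have dI: "d \<notin> I" using insert by simp
  let ?M = "\<lambda>ps X Z i. if i = d then Z else wordA (ps i) X"
  show ?case
  proof (cases "\<sigma> i = i")
    case True
    then have "\<sigma> permutes ?J"
      using \<sigma> by (auto intro: permutes_superset)
    then obtain t qs where t: "t \<in> trace_funs A" and qs: "set qs \<subseteq> A \<times> UNIV"
      and eq: "\<And>X Z. contraction ?J (?M ps X Z) \<sigma> = t X * trace (Z ** wordA qs X)"
      using insert.IH[OF dI, of \<sigma> ps] insert.prems(3) by blast
    have "contraction (insert d (insert i I)) (?M ps X Z) \<sigma>
        = trace (wordA (ps i) X) * t X * trace (Z ** wordA qs X)" for X Z
      using i contraction_insert_fixed[OF i(2,1) \<open>\<sigma> permutes ?J\<close>, of "?M ps X Z"] eq by simp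
    moreover have "(\<lambda>X. trace (wordA (ps i) X) * t X) \<in> trace_funs A"
      using insert.prems t by (intro trace_funs.intros) auto
    ultimately show ?thesis
      using qs by (intro bexI[of _ "\<lambda>X. trace (wordA (ps i) X) * t X"] exI[of _ qs]) auto
  next
    case False
    define l where "l = inv \<sigma> i"
    have \<sigma>l: "\<sigma> l = i" using permutes_inverses(1)[OF \<sigma>] by (simp add: l_def)
    then have l: "l \<in> ?J"
      using False \<sigma> by (metis insertE insertI1 permutes_in_image)
    let ?\<tau> = "Transposition.transpose i (\<sigma> i) \<circ> \<sigma>"
    have "?\<tau> permutes insert i ?J"
      using permutes_in_image[OF \<sigma>, of i]
      by (intro permutes_compose[OF \<sigma>] permutes_swap_id) simp_all
    moreover have "?\<tau> i = i" by simp
    ultimately have \<tau>: "?\<tau> permutes ?J"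
      by (auto intro: permutes_superset)
    define ps' where "ps' = ps(l := ps l @ ps i)"
    have "set (ps' j) \<subseteq> A \<times> UNIV" if "j \<in> I" for j
      using insert.prems(3) that by (auto simp: ps'_def)
    then obtain t qs where t: "t \<in> trace_funs A" and qs: "set qs \<subseteq> A \<times> UNIV"
      and eq: "\<And>X Z. contraction ?J (?M ps' X Z) ?\<tau> = t X * trace (Z ** wordA qs X)"
      using insert.IH[OF dI \<tau>, of ps'] by blast
    have merge: "contraction (insert d (insert i I)) (?M ps X Z) \<sigma>
        = contraction ?J ((?M ps X Z)(l := ?M ps X Z l ** ?M ps X Z i)) ?\<tau>" for X Z
      using i contraction_insert_merge[OF i(2,1) \<sigma> l \<sigma>l, of "?M ps X Z"] by simp
    show ?thesis
    proof (cases "l = d")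
      case True
      have "contraction (insert d (insert i I)) (?M ps X Z) \<sigma>
          = t X * trace (Z ** wordA (ps i @ qs) X)" for X Z
      proof -
        have "contraction (insert d (insert i I)) (?M ps X Z) \<sigma>
            = contraction ?J (?M ps' X (Z ** wordA (ps i) X)) ?\<tau>"
          unfolding merge using True i dI by (intro contraction_cong) (auto simp: ps'_def)
        then show ?thesis by (simp add: eq wordA_append matrix_mul_assoc)
      qed
      moreover have "set (ps i @ qs) \<subseteq> A \<times> UNIV" using qs insert.prems(3) by simp
      ultimately show ?thesis using t by blast
    next
      case False
      have "contraction (insert d (insert i I)) (?M ps X Z) \<sigma> = t X * trace (Z ** wordA qs X)" for X Z
      proof -
        have "contraction (insert d (insert i I)) (?M ps X Z) \<sigma> = contraction ?J (?M ps' X Z) ?\<tau>"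
          unfolding merge using False i
          by (intro contraction_cong) (auto simp: ps'_def wordA_append)
        then show ?thesis by (simp add: eq)
      qed
      then show ?thesis using t qs by blast
    qed
  qed
qed

subsection \<open>Double centralizer\<close>

definition fun_scale :: "'a::times \<Rightarrow> ('b \<Rightarrow> 'a) \<Rightarrow> 'b \<Rightarrow> 'a" where
  "fun_scale c f = (\<lambda>x. c * f x)"

lemma fun_scale_apply: "fun_scale c f x = c * f x"
  by (simp add: fun_scale_def)

interpretation fun_vs: vector_space "fun_scale :: 'a::field \<Rightarrow> ('b \<Rightarrow> 'a) \<Rightarrow> _"
  by unfold_locales (auto simp: fun_scale_def algebra_simps)

interpretation fun_vs_pair: vector_space_pair
  "fun_scale :: 'a::field \<Rightarrow> ('b \<Rightarrow> 'a) \<Rightarrow> _" "fun_scale :: 'a::field \<Rightarrow> ('b \<Rightarrow> 'a) \<Rightarrow> _" ..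

lemma sum_fun_apply: "(\<Sum>i\<in>I. f i) x = (\<Sum>i\<in>I. f i x)"
  by (induction I rule: infinite_finite_induct) auto

text \<open>In matrix terms this is a solution \<open>w\<close> of \<open>v = v w v\<close>. A
  linear projection \<open>g\<close> onto the row space fixes every row, and row \<open>p\<close> of
  \<open>w\<close> consists of coefficients expressing the projection of the \<open>p\<close>-th
  unit vector through the rows.\<close>

lemma generalized_inverse:
  fixes v :: "'r \<Rightarrow> 'b \<Rightarrow> 'a::field"
  assumes "finite R" "finite \<Theta>"
  obtains w where "\<And>r y. r \<in> R \<Longrightarrow> y \<in> \<Theta> \<Longrightarrow> v r y = (\<Sum>p\<in>\<Theta>. v r p * (\<Sum>s\<in>R. w p s * v s y))"
proof -
  \<comment> \<open>Cutting off outside \<open>\<Theta>\<close> makes each row a finite combination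
    of unit vectors.\<close>
  define v' where "v' r y = (if y \<in> \<Theta> then v r y else 0)" for r y
  let ?V = "fun_vs.span (v' ` R)"
  obtain g where g: "range g \<subseteq> ?V" "Vector_Spaces.linear fun_scale fun_scale g"
    "\<And>x. x \<in> ?V \<Longrightarrow> g x = x"
    using fun_vs_pair.linear_exists_left_inverse_on[OF fun_vs.linear_id fun_vs.subspace_span, of "v' ` R"]
    by (auto simp: id_def)
  interpret g: Vector_Spaces.linear fun_scale fun_scale g by fact
  have "\<exists>c. x = (\<lambda>y. \<Sum>s\<in>R. c s * v' s y)" if "x \<in> ?V" for x
    using that
  proof (induction rule: fun_vs.span_induct)
    case base
    show ?case
    proof (rule fun_vs.subspaceI)
      show "0 \<in> {x. \<exists>c. x = (\<lambda>y. \<Sum>s\<in>R. c s * v' s y)}"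
        by (auto intro!: exI[of _ "\<lambda>_. 0"])
      show "x + z \<in> {x. \<exists>c. x = (\<lambda>y. \<Sum>s\<in>R. c s * v' s y)}"
        if xz: "x \<in> {x. \<exists>c. x = (\<lambda>y. \<Sum>s\<in>R. c s * v' s y)}"
          "z \<in> {x. \<exists>c. x = (\<lambda>y. \<Sum>s\<in>R. c s * v' s y)}" for x z
      proof -
        obtain c d where "x = (\<lambda>y. \<Sum>s\<in>R. c s * v' s y)" "z = (\<lambda>y. \<Sum>s\<in>R. d s * v' s y)"
          using xz by blast
        then have "x + z = (\<lambda>y. \<Sum>s\<in>R. (c s + d s) * v' s y)"
          by (auto simp: fun_eq_iff sum.distrib algebra_simps)
        then show ?thesis by auto
      qed
      show "fun_scale e x \<in> {x. \<exists>c. x = (\<lambda>y. \<Sum>s\<in>R. c s * v' s y)}"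
        if x: "x \<in> {x. \<exists>c. x = (\<lambda>y. \<Sum>s\<in>R. c s * v' s y)}" for x e
      proof -
        obtain c where "x = (\<lambda>y. \<Sum>s\<in>R. c s * v' s y)" using x by blast
        then have "fun_scale e x = (\<lambda>y. \<Sum>s\<in>R. (e * c s) * v' s y)"
          by (auto simp: fun_eq_iff fun_scale_apply sum_distrib_left algebra_simps)
        then show ?thesis by auto
      qed
    qed
  next
    case (step x)
    then obtain r where "r \<in> R" "x = v' r" by blast
    then show ?case
      using \<open>finite R\<close>
      by (intro exI[of _ "\<lambda>s. if s = r then 1 else 0"])
        (auto simp: fun_eq_iff if_distrib[of "\<lambda>c. c * _"] cong: if_cong)
  qed
  then have "\<forall>p. \<exists>c. g (\<lambda>y. if y = p then 1 else 0) = (\<lambda>y. \<Sum>s\<in>R. c s * v' s y)"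
    using g(1) by blast
  then obtain w where w: "\<And>p. g (\<lambda>y. if y = p then 1 else 0) = (\<lambda>y. \<Sum>s\<in>R. w p s * v' s y)"
    by metis
  show ?thesis
  proof (rule that[of w])
    fix r y assume r: "r \<in> R" and y: "y \<in> \<Theta>"
    have "v' r = (\<Sum>p\<in>\<Theta>. fun_scale (v r p) (\<lambda>y. if y = p then 1 else 0))"
      using \<open>finite \<Theta>\<close>
      by (auto simp: fun_eq_iff fun_scale_apply sum_fun_apply v'_def if_distrib[of "\<lambda>c. _ * c"] cong: if_cong)
    then have "g (v' r) y = (\<Sum>p\<in>\<Theta>. v r p * g (\<lambda>y. if y = p then 1 else 0) y)"
      by (simp add: g.sum g.scale sum_fun_apply fun_scale_apply)
    moreover have "g (v' r) = v' r" using r by (intro g(3) fun_vs.span_base) blast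
    ultimately show "v r y = (\<Sum>p\<in>\<Theta>. v r p * (\<Sum>s\<in>R. w p s * v s y))"
      using y by (simp add: v'_def w)
  qed
qed

text \<open>The density argument behind the double centralizer theorem: with \<^term>\<open>P\<close> a projection onto
  the span of the \<^term>\<open>v r\<close>, the map sending \<^term>\<open>Z\<close> to the sum of all
  \<^term>\<open>u r\<close> times \<^term>\<open>P (v r ** Z)\<close> commutes with left multiplication by \<^term>\<open>T\<close>
  and fixes the identity.\<close>

lemma double_centralizer:
  fixes u v :: "'r \<Rightarrow> 'w \<Rightarrow> 'w \<Rightarrow> 'a::field" and T :: "'w \<Rightarrow> 'w \<Rightarrow> 'a"
  assumes R: "finite R" and \<Omega>: "finite \<Omega>"
    and one: "\<And>x y. x \<in> \<Omega> \<Longrightarrow> y \<in> \<Omega> \<Longrightarrow> (\<Sum>r\<in>R. \<Sum>k\<in>\<Omega>. u r x k * v r k y) = (if x = y then 1 else 0)"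
    and comm: "\<And>x y p q. x \<in> \<Omega> \<Longrightarrow> y \<in> \<Omega> \<Longrightarrow> p \<in> \<Omega> \<Longrightarrow> q \<in> \<Omega> \<Longrightarrow>
      (\<Sum>z\<in>\<Omega>. T x z * (\<Sum>r\<in>R. u r z p * v r q y)) = (\<Sum>z\<in>\<Omega>. (\<Sum>r\<in>R. u r x p * v r q z) * T z y)"
  obtains \<beta> where "\<And>x y. x \<in> \<Omega> \<Longrightarrow> y \<in> \<Omega> \<Longrightarrow>
    T x y = (\<Sum>r\<in>R. \<Sum>s\<in>R. \<beta> r s * (\<Sum>k\<in>\<Omega>. u r x k * v s k y))"
proof -
  define V where "V r p = v r (fst p) (snd p)" for r p
  obtain w where w: "\<And>r p. r \<in> R \<Longrightarrow> p \<in> \<Omega> \<times> \<Omega> \<Longrightarrow>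
      V r p = (\<Sum>q\<in>\<Omega> \<times> \<Omega>. V r q * (\<Sum>s\<in>R. w q s * V s p))"
    using generalized_inverse[OF R finite_cartesian_product[OF \<Omega> \<Omega>], of V] by blast
  have v: "v r y j = (\<Sum>p\<in>\<Omega>. \<Sum>q\<in>\<Omega>. \<Sum>s\<in>R. v r p q * (w (p, q) s * v s y j))"
    if "r \<in> R" "y \<in> \<Omega>" "j \<in> \<Omega>" for r y j
    using w[of r "(y, j)"] that
    by (simp add: V_def sum.cartesian_product' sum_distrib_left)
  \<comment> \<open>The projection \<open>P\<close> sends the matrix unit at \<open>(p, q)\<close>
    to the combination of the \<open>v s\<close> with coefficients \<open>w (p, q) s\<close>. So
    \<open>\<beta> r s\<close> is the coefficient of \<open>v s\<close> in
    \<open>P (v r ** T)\<close>.\<close>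
  define \<beta> where "\<beta> r s = (\<Sum>p\<in>\<Omega>. \<Sum>q\<in>\<Omega>. \<Sum>z\<in>\<Omega>. v r p z * T z q * w (p, q) s)" for r s
  show ?thesis
  proof (rule that[of \<beta>])
    fix x j assume x: "x \<in> \<Omega>" and j: "j \<in> \<Omega>"
    let ?S = "\<Omega> \<times> \<Omega> \<times> \<Omega> \<times> R"
    have "T x j = (\<Sum>z\<in>\<Omega>. T x z * (\<Sum>r\<in>R. \<Sum>y\<in>\<Omega>. u r z y * v r y j))"
      using \<Omega> j by (simp add: one if_distrib[of "\<lambda>c. _ * c"] cong: if_cong)
    also have "\<dots> = (\<Sum>z\<in>\<Omega>. \<Sum>r\<in>R. \<Sum>y\<in>\<Omega>. T x z * (u r z y * (\<Sum>p\<in>\<Omega>. \<Sum>q\<in>\<Omega>. \<Sum>s\<in>R. v r p q * (w (p, q) s * v s y j))))"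
      using j by (simp add: sum_distrib_left v[symmetric])
    also have "\<dots> = (\<Sum>(z, r, y, p, q, s)\<in>\<Omega> \<times> R \<times> ?S. T x z * (u r z y * (v r p q * (w (p, q) s * v s y j))))"
      by (simp add: sum.cartesian_product' sum_distrib_left mult.assoc)
    also have "\<dots> = (\<Sum>((y, p, q, s), z, r)\<in>?S \<times> \<Omega> \<times> R. w (p, q) s * v s y j * (T x z * (u r z y * v r p q)))"
      by (rule sum.reindex_bij_witness[of _ "\<lambda>((y, p, q, s), z, r). (z, r, y, p, q, s)"
            "\<lambda>(z, r, y, p, q, s). ((y, p, q, s), z, r)"]) (auto simp: mult_ac)
    also have "\<dots> = (\<Sum>(y, p, q, s)\<in>?S. w (p, q) s * v s y j * (\<Sum>z\<in>\<Omega>. T x z * (\<Sum>r\<in>R. u r z y * v r p q)))"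
      by (simp add: sum.cartesian_product' sum_distrib_left case_prod_unfold)
    \<comment> \<open>Assumption \<open>comm\<close> states that \<open>T\<close> commutes with the
      sum of all \<open>u r ** E ** v r\<close> for each matrix unit \<open>E\<close>. With
      \<open>E\<close> in row \<open>y\<close> and column \<open>p\<close> it moves \<open>T\<close>
      from the left of \<open>u r\<close> to the right of \<open>v r\<close>, inside the argument of
      the projection.\<close>
    also have "\<dots> = (\<Sum>(y, p, q, s)\<in>?S. w (p, q) s * v s y j * (\<Sum>z\<in>\<Omega>. (\<Sum>r\<in>R. u r x y * v r p z) * T z q))"
      using comm x by (intro sum.cong refl) auto
    also have "\<dots> = (\<Sum>((y, p, q, s), z, r)\<in>?S \<times> \<Omega> \<times> R. w (p, q) s * v s y j * (u r x y * v r p z * T z q))"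
      by (simp add: sum.cartesian_product' sum_distrib_left sum_distrib_right case_prod_unfold)
    also have "\<dots> = (\<Sum>((r, s, y), p, q, z)\<in>(R \<times> R \<times> \<Omega>) \<times> \<Omega> \<times> \<Omega> \<times> \<Omega>.
        v r p z * T z q * w (p, q) s * (u r x y * v s y j))"
      by (rule sum.reindex_bij_witness[of _ "\<lambda>((r, s, y), p, q, z). ((y, p, q, s), z, r)"
            "\<lambda>((y, p, q, s), z, r). ((r, s, y), p, q, z)"]) (auto simp: mult_ac)
    also have "\<dots> = (\<Sum>r\<in>R. \<Sum>s\<in>R. \<beta> r s * (\<Sum>k\<in>\<Omega>. u r x k * v s k j))"
      by (simp add: sum.cartesian_product' sum_distrib_left sum_distrib_right case_prod_unfold \<beta>_def)
    finally show "T x j = \<dots>" .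
  qed
qed

section \<open>Matrix units, and operators commuting with tensor powers of the centralizer\<close>

lemma mult_munit: "(M ** munit k l) $ i $ j = (if j = l then M $ i $ k else 0)"
  by (cases "j = l") (simp_all add: matrix_mult_nth if_distrib[of "\<lambda>s. _ * s"] cong: if_cong)

lemma munit_mult: "(munit k l ** N) $ i $ j = (if i = k then N $ l $ j else 0)"
  by (cases "i = k") (simp_all add: matrix_mult_nth if_distrib[of "\<lambda>s. s * _"] cong: if_cong)

lemma mult_munit_mult: "(M ** munit k l ** N) $ i $ j = M $ i $ k * N $ l $ j"
  by (simp add: matrix_mult_nth[of "M ** _"] mult_munit if_distrib[of "\<lambda>s. s * _"] cong: if_cong)

lemma poly_det: "poly (det (\<chi> i j. P i j)) t = det (\<chi> i j. poly (P i j) t)"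
  for P :: "'n::finite \<Rightarrow> 'n \<Rightarrow> 'a::comm_ring_1 poly"
  by (simp add: det_def poly_sum poly_prod)

text \<open>Zariski density of the units of the centralizer, along the line from \<^term>\<open>mat 1\<close> to
  \<^term>\<open>c\<close>.\<close>

lemma commutes_units_imp_centralizer:
  fixes T :: "('i \<Rightarrow> 'n::finite) \<Rightarrow> ('i \<Rightarrow> 'n) \<Rightarrow> 'a::field_char_0"
    and A :: "('a, 'n) mat set" and I :: "'i set"
  defines "\<Omega> \<equiv> I \<rightarrow>\<^sub>E UNIV"
  assumes comm: "\<And>g x y. g \<in> centralizer_units A \<Longrightarrow> x \<in> \<Omega> \<Longrightarrow> y \<in> \<Omega> \<Longrightarrow>
      (\<Sum>z\<in>\<Omega>. T x z * (\<Prod>i\<in>I. g $ z i $ y i)) = (\<Sum>z\<in>\<Omega>. (\<Prod>i\<in>I. g $ x i $ z i) * T z y)"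
    and c: "\<And>a. a \<in> A \<Longrightarrow> c ** a = a ** c" and xy: "x \<in> \<Omega>" "y \<in> \<Omega>"
  shows "(\<Sum>z\<in>\<Omega>. T x z * (\<Prod>i\<in>I. c $ z i $ y i)) = (\<Sum>z\<in>\<Omega>. (\<Prod>i\<in>I. c $ x i $ z i) * T z y)"
proof -
  define P where "P i j = [:mat 1 $ i $ j, c $ i $ j - mat 1 $ i $ j:]" for i j
  define h where "h t = mat 1 + msmult t (c - mat 1)" for t
  have h: "poly (P i j) t = h t $ i $ j" for i j t by (simp add: P_def h_def)
  define q where "q = (\<Sum>z\<in>\<Omega>. [:T x z:] * (\<Prod>i\<in>I. P (z i) (y i)))
    - (\<Sum>z\<in>\<Omega>. (\<Prod>i\<in>I. P (x i) (z i)) * [:T z y:])"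
  have q: "poly q t = (\<Sum>z\<in>\<Omega>. T x z * (\<Prod>i\<in>I. h t $ z i $ y i))
    - (\<Sum>z\<in>\<Omega>. (\<Prod>i\<in>I. h t $ x i $ z i) * T z y)" for t
    by (simp add: q_def poly_sum poly_prod h mult.commute)
  define d where "d = det (\<chi> i j. P i j)"
  have d: "poly d t = det (h t)" for t
  proof -
    have "(\<chi> i j. h t $ i $ j) = h t" by (simp add: vec_eq_iff)
    then show ?thesis by (simp add: d_def poly_det h)
  qed
  have h_comm: "h t ** a = a ** h t" if "a \<in> A" for a t
    using c[OF that]
    by (simp add: h_def matrix_add_ldistrib matrix_add_rdistrib matrix_diff_ldistrib matrix_diff_rdistrib)
  \<comment> \<open>\<open>q\<close> vanishes wherever \<open>h t\<close> is invertible, and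
    \<open>d\<close> vanishes everywhere else. As \<open>d\<close> takes the value 1 at 0, the
    factor that is zero as a polynomial must be \<open>q\<close>, and \<open>t = 1\<close> gives the
    claim for \<open>c\<close> itself.\<close>
  have "poly (q * d) t = 0" for t
  proof (cases "det (h t) = 0")
    case False
    then have "h t \<in> centralizer_units A"
      using h_comm by (simp add: centralizer_units_def invertible_det_nz)
    then show ?thesis using comm xy by (simp add: q)
  qed (simp add: d)
  then have "q * d = 0" using poly_all_0_iff_0 by blast
  moreover have "poly d 0 = 1" by (simp add: d h_def mat_vs.scale_zero_left)
  then have "d \<noteq> 0" by auto
  ultimately have "poly q 1 = 0" by simp
  moreover have "h 1 = c" by (simp add: h_def)
  ultimately show ?thesis by (simp add: q)
qed

text \<open>By polarization the symmetrized tensor of the \<open>c i\<close> is an alternating sum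
  of tensor powers of the partial sums of the \<open>c i\<close>. Each partial sum lies in
  \<open>C\<close>, where commutation is assumed.\<close>

lemma commutes_permanent:
  fixes T :: "('i \<Rightarrow> 'n::finite) \<Rightarrow> ('i \<Rightarrow> 'n) \<Rightarrow> 'a::comm_ring_1"
    and C :: "('a, 'n) mat set" and I :: "'i set"
  defines "\<Omega> \<equiv> I \<rightarrow>\<^sub>E UNIV"
  assumes I: "finite I"
    and comm: "\<And>c. c \<in> C \<Longrightarrow>
      (\<Sum>z\<in>\<Omega>. T x z * (\<Prod>i\<in>I. c $ z i $ y i)) = (\<Sum>z\<in>\<Omega>. (\<Prod>i\<in>I. c $ x i $ z i) * T z y)"
    and C: "\<And>S. S \<subseteq> I \<Longrightarrow> (\<Sum>i\<in>S. c i) \<in> C"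
  shows "(\<Sum>z\<in>\<Omega>. T x z * (\<Sum>\<sigma> | \<sigma> permutes I. \<Prod>i\<in>I. c (\<sigma> i) $ z i $ y i))
    = (\<Sum>z\<in>\<Omega>. (\<Sum>\<sigma> | \<sigma> permutes I. \<Prod>i\<in>I. c (\<sigma> i) $ x i $ z i) * T z y)"
proof -
  let ?e = "\<lambda>S. (-1) ^ (card I - card S) :: 'a"
  have perm: "(\<Sum>\<sigma> | \<sigma> permutes I. \<Prod>i\<in>I. c (\<sigma> i) $ p i $ q i)
      = (\<Sum>S\<in>Pow I. ?e S * (\<Prod>i\<in>I. (\<Sum>j\<in>S. c j) $ p i $ q i))" for p q
    using permanent_polarization[OF I, of "\<lambda>i j. c j $ p i $ q i"] by (simp add: sum_component)
  have "(\<Sum>z\<in>\<Omega>. T x z * (\<Sum>\<sigma> | \<sigma> permutes I. \<Prod>i\<in>I. c (\<sigma> i) $ z i $ y i))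
      = (\<Sum>S\<in>Pow I. ?e S * (\<Sum>z\<in>\<Omega>. T x z * (\<Prod>i\<in>I. (\<Sum>j\<in>S. c j) $ z i $ y i)))"
    unfolding perm sum_distrib_left by (subst sum.swap) (simp add: mult_ac)
  also have "\<dots> = (\<Sum>S\<in>Pow I. ?e S * (\<Sum>z\<in>\<Omega>. (\<Prod>i\<in>I. (\<Sum>j\<in>S. c j) $ x i $ z i) * T z y))"
    using comm C by (intro sum.cong refl) (simp del: sum_component)
  also have "\<dots> = (\<Sum>z\<in>\<Omega>. (\<Sum>\<sigma> | \<sigma> permutes I. \<Prod>i\<in>I. c (\<sigma> i) $ x i $ z i) * T z y)"
    unfolding perm sum_distrib_left sum_distrib_right by (subst sum.swap) (simp add: mult_ac)
  finally show ?thesis .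
qed

text \<open>An index in the inner set \<open>R\<close> consists of a permutation of the tensor
  positions and a choice of a Casimir basis element at each position. Sending \<open>N\<close> to
  the sum of all \<open>u r ** N ** w r\<close> then averages over the symmetric group and applies
  the Casimir operator at every position. It fixes the identity, and its values are symmetrized
  tensors over the centralizer, so \<open>double_centralizer\<close> applies. The resulting products
  of some \<open>u r\<close> with some \<open>w s\<close> are indexed by pairs, which explains the
  type of the set obtained in the statement.\<close>

lemma tensor_double_centralizer:
  fixes T :: "('i \<Rightarrow> 'n::finite) \<Rightarrow> ('i \<Rightarrow> 'n) \<Rightarrow> 'a::field_char_0"
    and A :: "('a, 'n) mat set" and I :: "'i set"
  defines "\<Omega> \<equiv> I \<rightarrow>\<^sub>E UNIV"
  assumes ss: "semisimple_subalgebra A" and I: "finite I"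
    and comm: "\<And>g x y. g \<in> centralizer_units A \<Longrightarrow> x \<in> \<Omega> \<Longrightarrow> y \<in> \<Omega> \<Longrightarrow>
      (\<Sum>z\<in>\<Omega>. T x z * (\<Prod>i\<in>I. g $ z i $ y i)) = (\<Sum>z\<in>\<Omega>. (\<Prod>i\<in>I. g $ x i $ z i) * T z y)"
  obtains R :: "((('i \<Rightarrow> 'i) \<times> ('i \<Rightarrow> ('a, 'n) mat)) \<times> (('i \<Rightarrow> 'i) \<times> ('i \<Rightarrow> ('a, 'n) mat))) set"
    and \<beta> a \<tau> where "finite R" "\<And>r. r \<in> R \<Longrightarrow> \<tau> r permutes I" "\<And>r i. r \<in> R \<Longrightarrow> i \<in> I \<Longrightarrow> a r i \<in> A"
    "\<And>x y. x \<in> \<Omega> \<Longrightarrow> y \<in> \<Omega> \<Longrightarrow> T x y = (\<Sum>r\<in>R. \<beta> r * (\<Prod>i\<in>I. a r i $ x i $ y (\<tau> r i)))"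
proof -
  have A: "unital_subalgebra A" using ss by (simp add: semisimple_subalgebra_def)
  obtain B v where B: "finite B" "B \<subseteq> A" "v ` B \<subseteq> A" and Bv: "(\<Sum>b\<in>B. b ** v b) = mat 1"
    and cas: "\<And>a M. a \<in> A \<Longrightarrow> (\<Sum>b\<in>B. a ** b ** M ** v b) = (\<Sum>b\<in>B. b ** M ** v b ** a)"
    by (rule semisimple_casimir[OF ss], rule that)
  have \<Omega>: "finite \<Omega>" unfolding \<Omega>_def using I by (intro finite_PiE) auto
  let ?S = "{\<sigma>. \<sigma> permutes I}"
  let ?f = "inverse (of_nat (card ?S)) :: 'a"
  have S: "finite ?S" "of_nat (card ?S) \<noteq> (0 :: 'a)"
    using I by (auto simp: card_permutations finite_permutations)
  define R where "R = ?S \<times> (I \<rightarrow>\<^sub>E B)"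
  have R: "finite R" unfolding R_def using I B S(1) by (intro finite_cartesian_product finite_PiE) auto
  define u where "u r p x = ?f * (\<Prod>i\<in>I. snd r i $ p (fst r i) $ x i)"
    for r :: "('i \<Rightarrow> 'i) \<times> ('i \<Rightarrow> ('a, 'n) mat)" and p x :: "'i \<Rightarrow> 'n"
  define w where "w r y q = (\<Prod>i\<in>I. v (snd r i) $ y i $ q (fst r i))"
    for r :: "('i \<Rightarrow> 'i) \<times> ('i \<Rightarrow> ('a, 'n) mat)" and y q :: "'i \<Rightarrow> 'n"
  have uw: "(\<Sum>r\<in>R. u r p x * w r y q)
      = ?f * (\<Sum>\<sigma>\<in>?S. \<Prod>i\<in>I. \<Sum>b\<in>B. b $ p (\<sigma> i) $ x i * v b $ y i $ q (\<sigma> i))" for p x y q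
  proof -
    have "(\<Sum>r\<in>R. u r p x * w r y q)
        = ?f * (\<Sum>\<sigma>\<in>?S. \<Sum>\<rho>\<in>I \<rightarrow>\<^sub>E B. \<Prod>i\<in>I. \<rho> i $ p (\<sigma> i) $ x i * v (\<rho> i) $ y i $ q (\<sigma> i))"
      by (simp add: R_def u_def w_def sum.cartesian_product' sum_distrib_left prod.distrib mult.assoc)
    then show ?thesis using I B(1) by (simp add: prod_sum_PiE)
  qed
  have one: "(\<Sum>r\<in>R. \<Sum>k\<in>\<Omega>. u r x k * w r k y) = (if x = y then 1 else 0)"
    if xy: "x \<in> \<Omega>" "y \<in> \<Omega>" for x y
  proof -
    have "(\<Sum>r\<in>R. \<Sum>k\<in>\<Omega>. u r x k * w r k y)
        = ?f * (\<Sum>k\<in>\<Omega>. \<Sum>\<sigma>\<in>?S. \<Prod>i\<in>I. \<Sum>b\<in>B. b $ x (\<sigma> i) $ k i * v b $ k i $ y (\<sigma> i))"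
      by (subst sum.swap) (simp add: uw sum_distrib_left)
    also have "\<dots> = ?f * (\<Sum>\<sigma>\<in>?S. \<Prod>i\<in>I. \<Sum>l\<in>UNIV. \<Sum>b\<in>B. b $ x (\<sigma> i) $ l * v b $ l $ y (\<sigma> i))"
      using I by (subst sum.swap) (simp add: \<Omega>_def prod_sum_PiE)
    also have "\<dots> = ?f * (\<Sum>\<sigma>\<in>?S. \<Prod>i\<in>I. mat 1 $ x (\<sigma> i) $ y (\<sigma> i))"
      by (subst sum.swap) (simp add: matrix_mult_nth flip: Bv)
    also have "\<dots> = ?f * (\<Sum>\<sigma>\<in>?S. \<Prod>i\<in>I. mat 1 $ x i $ y i)"
      by (intro arg_cong[of _ _ "(*) ?f"] sum.cong refl)
        (simp add: prod.permute[of _ I "\<lambda>i. mat 1 $ x i $ y i"] comp_def)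
    also have "\<dots> = (\<Prod>i\<in>I. mat 1 $ x i $ y i)" using S(2) by simp
    also have "\<dots> = (if x = y then 1 else 0)"
    proof (cases "x = y")
      case False
      then obtain i where "i \<in> I" "x i \<noteq> y i" using xy PiE_ext unfolding \<Omega>_def by metis
      then show ?thesis using False I by (auto simp: mat_def intro: prod_zero)
    qed (simp add: mat_def)
    finally show ?thesis .
  qed
  let ?C = "{c. \<forall>a\<in>A. c ** a = a ** c}"
  have comm': "(\<Sum>z\<in>\<Omega>. T x z * (\<Sum>r\<in>R. u r z p * w r q y)) = (\<Sum>z\<in>\<Omega>. (\<Sum>r\<in>R. u r x p * w r q z) * T z y)"
    if xy: "x \<in> \<Omega>" "y \<in> \<Omega>" for x y p q
  proof -
    \<comment> \<open>At the matrix unit with row \<open>p\<close> and column \<open>q\<close> the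
      average becomes the symmetrized tensor of these \<open>c i\<close>, and the Casimir identity
      puts each \<open>c i\<close> into the centralizer.\<close>
    define c where "c i = (\<Sum>b\<in>B. b ** munit (p i) (q i) ** v b)" for i
    have c: "c i \<in> ?C" for i
      using cas by (simp add: c_def matrix_sum_ldistrib matrix_sum_rdistrib matrix_mul_assoc)
    have uwc: "(\<Sum>r\<in>R. u r z p * w r q y) = ?f * (\<Sum>\<sigma>\<in>?S. \<Prod>i\<in>I. c (\<sigma> i) $ z i $ y i)" for z y
    proof -
      have "(\<Sum>r\<in>R. u r z p * w r q y) = ?f * (\<Sum>\<sigma>\<in>?S. \<Prod>i\<in>I. c i $ z (\<sigma> i) $ y (\<sigma> i))"
        by (simp add: uw c_def mult_munit_mult)
      also have "(\<Sum>\<sigma>\<in>?S. \<Prod>i\<in>I. c i $ z (\<sigma> i) $ y (\<sigma> i))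
          = (\<Sum>\<sigma>\<in>?S. \<Prod>i\<in>I. c (inv \<sigma> i) $ z i $ y i)"
      proof (intro sum.cong refl)
        fix \<sigma> assume "\<sigma> \<in> ?S"
        then have \<sigma>: "\<sigma> permutes I" by simp
        show "(\<Prod>i\<in>I. c i $ z (\<sigma> i) $ y (\<sigma> i)) = (\<Prod>i\<in>I. c (inv \<sigma> i) $ z i $ y i)"
          using prod.permute[OF \<sigma>, of "\<lambda>i. c (inv \<sigma> i) $ z i $ y i"]
          by (simp add: comp_def permutes_inverses[OF \<sigma>])
      qed
      also have "\<dots> = (\<Sum>\<sigma>\<in>?S. \<Prod>i\<in>I. c (\<sigma> i) $ z i $ y i)"
        by (rule sum_permutations_inverse[symmetric])
      finally show ?thesis .
    qed
    have commC: "(\<Sum>z\<in>\<Omega>. T x z * (\<Prod>i\<in>I. d $ z i $ y i)) = (\<Sum>z\<in>\<Omega>. (\<Prod>i\<in>I. d $ x i $ z i) * T z y)"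
      if "d \<in> ?C" for d
      unfolding \<Omega>_def
    proof (rule commutes_units_imp_centralizer[where A = A])
      show "x \<in> I \<rightarrow>\<^sub>E UNIV" "y \<in> I \<rightarrow>\<^sub>E UNIV" using xy by (simp_all add: \<Omega>_def)
      show "d ** a = a ** d" if "a \<in> A" for a using that \<open>d \<in> ?C\<close> by simp
    qed (fact comm[unfolded \<Omega>_def])
    have sumC: "(\<Sum>i\<in>S. c i) \<in> ?C" for S
      using c by (simp add: matrix_sum_ldistrib matrix_sum_rdistrib)
    have "(\<Sum>z\<in>\<Omega>. T x z * (\<Sum>\<sigma>\<in>?S. \<Prod>i\<in>I. c (\<sigma> i) $ z i $ y i))
        = (\<Sum>z\<in>\<Omega>. (\<Sum>\<sigma>\<in>?S. \<Prod>i\<in>I. c (\<sigma> i) $ x i $ z i) * T z y)"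
      unfolding \<Omega>_def
      by (rule commutes_permanent[OF I, where C = ?C]) (fact commC[unfolded \<Omega>_def], rule sumC)
    then show ?thesis
      by (simp add: uwc mult.left_commute[of _ ?f] mult.assoc flip: sum_distrib_left)
  qed
  obtain \<beta> where \<beta>: "\<And>x y. x \<in> \<Omega> \<Longrightarrow> y \<in> \<Omega> \<Longrightarrow>
      T x y = (\<Sum>r\<in>R. \<Sum>s\<in>R. \<beta> r s * (\<Sum>k\<in>\<Omega>. u r x k * w s k y))"
    using double_centralizer[of R \<Omega> u w T] R \<Omega> one comm' by blast
  \<comment> \<open>In the product of \<open>u r\<close> and \<open>w s\<close>, position
    \<open>i\<close> on the left is first sent back by the permutation of \<open>r\<close>, picks up
    there the product of two elements of \<open>A\<close>, and is then moved by the permutation of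
    \<open>s\<close>.\<close>
  define \<tau> where "\<tau> p = fst (snd p) \<circ> inv (fst (fst p))"
    for p :: "(('i \<Rightarrow> 'i) \<times> ('i \<Rightarrow> ('a, 'n) mat)) \<times> (('i \<Rightarrow> 'i) \<times> ('i \<Rightarrow> ('a, 'n) mat))"
  define a where "a p i = snd (fst p) (inv (fst (fst p)) i) ** v (snd (snd p) (inv (fst (fst p)) i))"
    for p :: "(('i \<Rightarrow> 'i) \<times> ('i \<Rightarrow> ('a, 'n) mat)) \<times> (('i \<Rightarrow> 'i) \<times> ('i \<Rightarrow> ('a, 'n) mat))" and i
  have uw': "(\<Sum>k\<in>\<Omega>. u r x k * w s k y) = ?f * (\<Prod>i\<in>I. a (r, s) i $ x i $ y (\<tau> (r, s) i))"
    if "r \<in> R" "s \<in> R" for r s x y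
  proof -
    have \<sigma>: "fst r permutes I" using that by (auto simp: R_def)
    have "(\<Sum>k\<in>\<Omega>. u r x k * w s k y)
        = ?f * (\<Sum>k\<in>\<Omega>. \<Prod>i\<in>I. snd r i $ x (fst r i) $ k i * v (snd s i) $ k i $ y (fst s i))"
      by (simp add: u_def w_def sum_distrib_left prod.distrib mult.assoc)
    also have "\<dots> = ?f * (\<Prod>i\<in>I. (snd r i ** v (snd s i)) $ x (fst r i) $ y (fst s i))"
      using I by (simp add: \<Omega>_def prod_sum_PiE matrix_mult_nth)
    also have "(\<Prod>i\<in>I. (snd r i ** v (snd s i)) $ x (fst r i) $ y (fst s i))
        = (\<Prod>i\<in>I. a (r, s) i $ x i $ y (\<tau> (r, s) i))"
      using prod.permute[OF \<sigma>, of "\<lambda>i. a (r, s) i $ x i $ y (\<tau> (r, s) i)"]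
      by (simp add: comp_def permutes_inverses[OF \<sigma>] a_def \<tau>_def)
    finally show ?thesis .
  qed
  show ?thesis
  proof (rule that[of "R \<times> R" \<tau> a "\<lambda>(r, s). \<beta> r s * ?f"])
    show "finite (R \<times> R)" using R by simp
    show "\<tau> r permutes I" if "r \<in> R \<times> R" for r
      using that by (auto simp: \<tau>_def R_def intro!: permutes_compose permutes_inv)
    show "a r i \<in> A" if r: "r \<in> R \<times> R" and i: "i \<in> I" for r i
    proof -
      obtain \<sigma> \<rho> \<sigma>' \<rho>' where eq: "r = ((\<sigma>, \<rho>), (\<sigma>', \<rho>'))" by (metis surj_pair)
      then have "\<sigma> permutes I" "\<rho> \<in> I \<rightarrow>\<^sub>E B" "\<rho>' \<in> I \<rightarrow>\<^sub>E B" using r by (auto simp: R_def)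
      then have "\<rho> (inv \<sigma> i) \<in> B" "\<rho>' (inv \<sigma> i) \<in> B"
        using i permutes_in_image[OF permutes_inv] by (metis PiE_mem)+
      then show ?thesis using B subalgebra_mult[OF A] by (auto simp: a_def eq)
    qed
    show "T x y = (\<Sum>r\<in>R \<times> R. (\<lambda>(r, s). \<beta> r s * ?f) r * (\<Prod>i\<in>I. a r i $ x i $ y (\<tau> r i)))"
      if "x \<in> \<Omega>" "y \<in> \<Omega>" for x y
      using that by (simp add: \<beta> uw' sum.cartesian_product' mult.assoc)
  qed
qed

section \<open>Multilinear forms invariant under simultaneous conjugation\<close>

lemma matrix_inv_mult:
  assumes "invertible g"
  shows "g ** matrix_inv g = mat 1" "matrix_inv g ** g = mat 1"
  using someI_ex[OF assms[unfolded invertible_def]] by (simp_all add: matrix_inv_def)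

text \<open>The value \<open>F M\<close> is the trace of \<open>T\<close> times the tensor product
  of the \<open>M i\<close>, so invariance under conjugation amounts to \<open>T\<close> commuting
  with the tensor powers of \<open>g\<close>. Matrix units in place of the \<open>M i\<close> read
  off the entries of this commutation relation. The operators describing \<open>T\<close> turn into
  contractions under the same trace.\<close>

lemma multilinear_invariant:
  fixes F :: "('i \<Rightarrow> ('a::field_char_0, 'n::finite) mat) \<Rightarrow> 'a"
    and A :: "('a, 'n) mat set" and I :: "'i set"
  assumes ss: "semisimple_subalgebra A" and I: "finite I"
    and F: "\<And>M. F M = (\<Sum>x\<in>I \<rightarrow>\<^sub>E UNIV. \<Sum>y\<in>I \<rightarrow>\<^sub>E UNIV. T x y * (\<Prod>i\<in>I. M i $ y i $ x i))"
    and inv: "\<And>g M. g \<in> centralizer_units A \<Longrightarrow> F (\<lambda>i. g ** M i ** matrix_inv g) = F M"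
  obtains R :: "((('i \<Rightarrow> 'i) \<times> ('i \<Rightarrow> ('a, 'n) mat)) \<times> (('i \<Rightarrow> 'i) \<times> ('i \<Rightarrow> ('a, 'n) mat))) set"
    and \<beta> a \<tau> where "finite R" "\<And>r. r \<in> R \<Longrightarrow> \<tau> r permutes I" "\<And>r i. r \<in> R \<Longrightarrow> i \<in> I \<Longrightarrow> a r i \<in> A"
    "\<And>M. F M = (\<Sum>r\<in>R. \<beta> r * contraction I (\<lambda>i. a r i ** M (\<tau> r i)) (\<tau> r))"
proof -
  let ?\<Omega> = "I \<rightarrow>\<^sub>E (UNIV :: 'n set)"
  have \<Omega>: "finite ?\<Omega>" using I by (intro finite_PiE) auto
  have ind: "(\<Prod>i\<in>I. if x i = l i then f i else 0) = (if x = l then prod f I else 0)"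
    if xl: "x \<in> ?\<Omega>" "l \<in> ?\<Omega>" for x l :: "'i \<Rightarrow> 'n" and f :: "'i \<Rightarrow> 'a"
  proof (cases "x = l")
    case False
    then obtain i where "i \<in> I" "x i \<noteq> l i" using PiE_ext[OF xl] by blast
    then have "(\<Prod>i\<in>I. if x i = l i then f i else 0) = 0" using I by (intro prod_zero) auto
    then show ?thesis using False by simp
  qed simp
  have comm: "(\<Sum>z\<in>?\<Omega>. T x z * (\<Prod>i\<in>I. g $ z i $ y i)) = (\<Sum>z\<in>?\<Omega>. (\<Prod>i\<in>I. g $ x i $ z i) * T z y)"
    if g: "g \<in> centralizer_units A" and xy: "x \<in> ?\<Omega>" "y \<in> ?\<Omega>" for g x y
  proof -
    define N where "N i = (munit (y i) (x i) :: ('a, 'n) mat)" for i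
    have "g ** matrix_inv g = mat 1"
      using g by (simp add: centralizer_units_def matrix_inv_mult)
    \<comment> \<open>Invariance is applied to \<open>N i ** g\<close> instead of
      \<open>N i\<close>, which leaves no inverse on either side of the relation obtained.\<close>
    then have "(\<lambda>i. g ** N i) = (\<lambda>i. g ** (N i ** g) ** matrix_inv g)"
      by (simp add: matrix_mul_assoc[symmetric])
    then have "F (\<lambda>i. g ** N i) = F (\<lambda>i. N i ** g)" using inv[OF g] by simp
    moreover have "F (\<lambda>i. g ** N i) = (\<Sum>z\<in>?\<Omega>. T x z * (\<Prod>i\<in>I. g $ z i $ y i))"
      using xy \<Omega>
      by (simp add: F N_def mult_munit ind if_distrib[of "\<lambda>s. _ * s"] sum.swap[of _ ?\<Omega> ?\<Omega>] cong: if_cong)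
    moreover have "F (\<lambda>i. N i ** g) = (\<Sum>z\<in>?\<Omega>. (\<Prod>i\<in>I. g $ x i $ z i) * T z y)"
      using xy \<Omega>
      by (simp add: F N_def munit_mult ind if_distrib[of "\<lambda>s. _ * s"] mult.commute cong: if_cong)
    ultimately show ?thesis by simp
  qed
  obtain R :: "((('i \<Rightarrow> 'i) \<times> ('i \<Rightarrow> ('a, 'n) mat)) \<times> (('i \<Rightarrow> 'i) \<times> ('i \<Rightarrow> ('a, 'n) mat))) set"
    and \<beta> a \<tau> where R: "finite R" "\<And>r. r \<in> R \<Longrightarrow> \<tau> r permutes I"
      "\<And>r i. r \<in> R \<Longrightarrow> i \<in> I \<Longrightarrow> a r i \<in> A"
    and T: "\<And>x y. x \<in> ?\<Omega> \<Longrightarrow> y \<in> ?\<Omega> \<Longrightarrow> T x y = (\<Sum>r\<in>R. \<beta> r * (\<Prod>i\<in>I. a r i $ x i $ y (\<tau> r i)))"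
    by (rule tensor_double_centralizer[OF ss I comm], assumption+, rule that)
  have contr: "(\<Sum>x\<in>?\<Omega>. \<Sum>y\<in>?\<Omega>. (\<Prod>i\<in>I. a r i $ x i $ y (\<tau> r i)) * (\<Prod>i\<in>I. M i $ y i $ x i))
      = contraction I (\<lambda>i. a r i ** M (\<tau> r i)) (\<tau> r)" if r: "r \<in> R" for r M
    unfolding contraction_def
  proof (intro sum.cong refl)
    fix x
    note \<tau> = R(2)[OF r]
    let ?f = "\<lambda>i k. a r i $ x i $ k * M (\<tau> r i) $ k $ x (\<tau> r i)"
    \<comment> \<open>Once the second product is reindexed by \<open>\<tau> r\<close>, each
      coordinate of \<open>y\<close> occurs in a single factor \<open>?f\<close>. The sum over
      \<open>y\<close> therefore splits into one matrix product per position.\<close>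
    have "(\<Prod>i\<in>I. a r i $ x i $ y (\<tau> r i)) * (\<Prod>i\<in>I. M i $ y i $ x i)
        = (\<Prod>i\<in>I. ?f (inv (\<tau> r) i) (y i))" for y
    proof -
      have "(\<Prod>i\<in>I. a r i $ x i $ y (\<tau> r i)) * (\<Prod>i\<in>I. M i $ y i $ x i) = (\<Prod>i\<in>I. ?f i (y (\<tau> r i)))"
        using prod.permute[OF \<tau>, of "\<lambda>i. M i $ y i $ x i"] by (simp add: comp_def prod.distrib)
      also have "\<dots> = (\<Prod>i\<in>I. ?f (inv (\<tau> r) i) (y i))"
        using prod.permute[OF \<tau>, of "\<lambda>i. ?f (inv (\<tau> r) i) (y i)"]
        by (simp add: comp_def permutes_inverses[OF \<tau>])
      finally show ?thesis .
    qed
    then have "(\<Sum>y\<in>?\<Omega>. (\<Prod>i\<in>I. a r i $ x i $ y (\<tau> r i)) * (\<Prod>i\<in>I. M i $ y i $ x i))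
        = (\<Prod>i\<in>I. \<Sum>k\<in>UNIV. ?f (inv (\<tau> r) i) k)"
      using I by (simp add: prod_sum_PiE)
    also have "\<dots> = (\<Prod>i\<in>I. \<Sum>k\<in>UNIV. ?f i k)"
      using prod.permute[OF \<tau>, of "\<lambda>i. \<Sum>k\<in>UNIV. ?f (inv (\<tau> r) i) k"]
      by (simp add: comp_def permutes_inverses[OF \<tau>])
    finally show "(\<Sum>y\<in>?\<Omega>. (\<Prod>i\<in>I. a r i $ x i $ y (\<tau> r i)) * (\<Prod>i\<in>I. M i $ y i $ x i))
        = (\<Prod>i\<in>I. (a r i ** M (\<tau> r i)) $ x i $ x (\<tau> r i))"
      by (simp add: matrix_mult_nth)
  qed
  have "F M = (\<Sum>r\<in>R. \<beta> r * contraction I (\<lambda>i. a r i ** M (\<tau> r i)) (\<tau> r))" for M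
  proof -
    have "F M = (\<Sum>x\<in>?\<Omega>. \<Sum>y\<in>?\<Omega>. \<Sum>r\<in>R. \<beta> r * ((\<Prod>i\<in>I. a r i $ x i $ y (\<tau> r i)) * (\<Prod>i\<in>I. M i $ y i $ x i)))"
      by (simp add: F T sum_distrib_right mult.assoc)
    also have "\<dots> = (\<Sum>r\<in>R. \<Sum>x\<in>?\<Omega>. \<Sum>y\<in>?\<Omega>. \<beta> r * ((\<Prod>i\<in>I. a r i $ x i $ y (\<tau> r i)) * (\<Prod>i\<in>I. M i $ y i $ x i)))"
      by (simp only: sum.swap[where A = ?\<Omega> and B = R])
    finally show ?thesis by (simp add: contr flip: sum_distrib_left)
  qed
  then show ?thesis using that R by blast
qed

subsection \<open>Polynomial maps\<close>

definition entry :: "'k \<times> 'n \<times> 'n \<Rightarrow> ('k \<Rightarrow> ('a, 'n::finite) mat) \<Rightarrow> 'a" where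
  "entry z X = X (fst z) $ fst (snd z) $ snd (snd z)"

text \<open>Monomials are kept as lists of coordinates instead of exponent vectors: the length is
  the degree, and each list position is a slot that polarization can fill with a matrix of its
  own.\<close>

lemma poly_funs_monomials:
  fixes p :: "('k \<Rightarrow> ('a::field, 'n::finite) mat) \<Rightarrow> 'a"
  shows "p \<in> poly_funs \<Longrightarrow> \<exists>L. \<forall>X. p X = (\<Sum>(c, zs)\<leftarrow>L. c * (\<Prod>z\<leftarrow>zs. entry z X))"
proof (induction rule: poly_funs.induct)
  case (pf_const c)
  then show ?case by (intro exI[of _ "[(c, [])]"]) simp
next
  case (pf_coord i r s)
  then show ?case by (intro exI[of _ "[(1, [(i, r, s)])]"]) (simp add: entry_def)
next
  case (pf_add p q)
  then obtain L L' where "\<And>X. p X = (\<Sum>(c, zs)\<leftarrow>L. c * (\<Prod>z\<leftarrow>zs. entry z X))"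
    "\<And>X. q X = (\<Sum>(c, zs)\<leftarrow>L'. c * (\<Prod>z\<leftarrow>zs. entry z X))" by blast
  then show ?case by (intro exI[of _ "L @ L'"]) simp
next
  case (pf_mult p q)
  then obtain L L' where L: "\<And>X. p X = (\<Sum>(c, zs)\<leftarrow>L. c * (\<Prod>z\<leftarrow>zs. entry z X))"
    "\<And>X. q X = (\<Sum>(c, zs)\<leftarrow>L'. c * (\<Prod>z\<leftarrow>zs. entry z X))" by blast
  define e where "e X = (\<lambda>(c, zs). c * (\<Prod>z\<leftarrow>zs. entry z X))"
    for X :: "'k \<Rightarrow> ('a, 'n) mat"
  have "sum_list (map (e X) (map (\<lambda>(d, ws). (c * d, zs @ ws)) L')) = e X (c, zs) * sum_list (map (e X) L')"
    for X c zs
    by (induction L') (auto simp: e_def algebra_simps)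
  then have "sum_list (map (e X) L) * sum_list (map (e X) L')
      = sum_list (map (e X) (concat (map (\<lambda>(c, zs). map (\<lambda>(d, ws). (c * d, zs @ ws)) L') L)))" for X
    by (induction L) (auto simp: distrib_right simp del: map_map)
  then show ?case using L unfolding e_def by auto
qed

lemma mixed_trace_polys_scale:
  "f \<in> mixed_trace_polys A \<Longrightarrow> (\<lambda>X. msmult c (f X)) \<in> mixed_trace_polys A"
proof (induction rule: mixed_trace_polys.induct)
  case mtp_zero
  then show ?case using mixed_trace_polys.mtp_zero by (simp add: mat_vs.scale_zero_right)
next
  case (mtp_term \<phi> ps a)
  then have "(\<lambda>X. msmult (c * \<phi> X) (wordA ps X ** a)) \<in> mixed_trace_polys A"
    by (intro mixed_trace_polys.mtp_term trace_funs.intros)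
  then show ?case by simp
next
  case (mtp_add f g)
  then show ?case using mixed_trace_polys.mtp_add by (simp add: mat_vs.scale_right_distrib)
qed

lemma mixed_trace_polys_sum:
  assumes "\<And>j. j \<in> J \<Longrightarrow> f j \<in> mixed_trace_polys A"
  shows "(\<lambda>X. \<Sum>j\<in>J. f j X) \<in> mixed_trace_polys A"
  using assms
proof (induction J rule: infinite_finite_induct)
  case (insert j J)
  then have "(\<lambda>X. f j X + (\<Sum>j\<in>J. f j X)) \<in> mixed_trace_polys A"
    by (intro mixed_trace_polys.mtp_add) auto
  then show ?case using insert.hyps by simp
qed (use mixed_trace_polys.mtp_zero in auto)

section \<open>The trace pairing and multilinear forms\<close>

lemma trace_munit: "trace (M ** munit q p) = M $ p $ q"
  by (simp add: trace_def mult_munit)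

lemma trace_msmult: "trace (msmult c M) = c * trace M"
  by (simp add: trace_def sum_distrib_left)

lemma trace_eqI:
  fixes M N :: "('a::semiring_1, 'n::finite) mat"
  assumes "\<And>Y. trace (M ** Y) = trace (N ** Y)"
  shows "M = N"
proof -
  have "M $ p $ q = N $ p $ q" for p q using assms[of "munit q p"] by (simp add: trace_munit)
  then show ?thesis by (simp add: mat_eq_iff)
qed

lemma trace_sum: "trace (\<Sum>i\<in>I. f i) = (\<Sum>i\<in>I. trace (f i))"
  unfolding trace_def by (simp add: sum_component) (rule sum.swap)

text \<open>The indices of \<open>M i\<close> are exchanged relative to those of \<open>T\<close>,
  so that the value is the trace of the operator \<open>T\<close> times the tensor product of the
  \<open>M i\<close>.\<close>

definition multilinear_form ::
  "'i set \<Rightarrow> (('i \<Rightarrow> ('a::comm_ring_1, 'n::finite) mat) \<Rightarrow> 'a) \<Rightarrow> bool" where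
  "multilinear_form I F \<longleftrightarrow> (\<exists>T. \<forall>M. F M
    = (\<Sum>x\<in>I \<rightarrow>\<^sub>E UNIV. \<Sum>y\<in>I \<rightarrow>\<^sub>E UNIV. T x y * (\<Prod>i\<in>I. M i $ y i $ x i)))"

lemma multilinear_form_zero: "multilinear_form I (\<lambda>M. 0)"
  unfolding multilinear_form_def by (rule exI[of _ "\<lambda>x y. 0"]) simp

lemma multilinear_form_add:
  assumes "multilinear_form I F" "multilinear_form I G"
  shows "multilinear_form I (\<lambda>M. F M + G M)"
proof -
  obtain S T where
    "\<And>M. F M = (\<Sum>x\<in>I \<rightarrow>\<^sub>E UNIV. \<Sum>y\<in>I \<rightarrow>\<^sub>E UNIV. S x y * (\<Prod>i\<in>I. M i $ y i $ x i))"
    "\<And>M. G M = (\<Sum>x\<in>I \<rightarrow>\<^sub>E UNIV. \<Sum>y\<in>I \<rightarrow>\<^sub>E UNIV. T x y * (\<Prod>i\<in>I. M i $ y i $ x i))"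
    using assms unfolding multilinear_form_def by blast
  then show ?thesis
    unfolding multilinear_form_def
    by (intro exI[of _ "\<lambda>x y. S x y + T x y"]) (simp add: distrib_right sum.distrib)
qed

lemma multilinear_form_scale:
  assumes "multilinear_form I F"
  shows "multilinear_form I (\<lambda>M. c * F M)"
proof -
  obtain T where
    "\<And>M. F M = (\<Sum>x\<in>I \<rightarrow>\<^sub>E UNIV. \<Sum>y\<in>I \<rightarrow>\<^sub>E UNIV. T x y * (\<Prod>i\<in>I. M i $ y i $ x i))"
    using assms unfolding multilinear_form_def by blast
  then show ?thesis
    unfolding multilinear_form_def
    by (intro exI[of _ "\<lambda>x y. c * T x y"]) (simp add: sum_distrib_left mult.assoc)
qed

lemma multilinear_form_sum:
  "(\<And>j. j \<in> J \<Longrightarrow> multilinear_form I (F j)) \<Longrightarrow> multilinear_form I (\<lambda>M. \<Sum>j\<in>J. F j M)"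
  by (induction J rule: infinite_finite_induct)
    (simp_all add: multilinear_form_zero multilinear_form_add)

lemma multilinear_form_monomial:
  assumes I: "finite I"
  shows "multilinear_form I (\<lambda>M. \<Prod>i\<in>I. M i $ r i $ s i)"
  unfolding multilinear_form_def
proof (intro exI allI)
  fix M :: "'a \<Rightarrow> ('b, 'c) mat"
  let ?\<Omega> = "I \<rightarrow>\<^sub>E (UNIV :: 'c set)"
  have \<Omega>: "finite ?\<Omega>" using I by (intro finite_PiE) auto
  let ?T = "\<lambda>x y. (if x = restrict s I then 1 else 0) * (if y = restrict r I then 1 else 0) :: 'b"
  have "(\<Sum>x\<in>?\<Omega>. \<Sum>y\<in>?\<Omega>. ?T x y * (\<Prod>i\<in>I. M i $ y i $ x i))
      = (\<Sum>x\<in>?\<Omega>. if x = restrict s I then \<Sum>y\<in>?\<Omega>. if y = restrict r I then \<Prod>i\<in>I. M i $ r i $ s i else 0 else 0)"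
    by (intro sum.cong refl) (auto intro!: sum.cong)
  also have "\<dots> = (\<Prod>i\<in>I. M i $ r i $ s i)" using \<Omega> by simp
  finally show "(\<Prod>i\<in>I. M i $ r i $ s i) = (\<Sum>x\<in>?\<Omega>. \<Sum>y\<in>?\<Omega>. ?T x y * (\<Prod>i\<in>I. M i $ y i $ x i))"
    by simp
qed

text \<open>One matrix \<^term>\<open>Y\<close> is kept apart from the variables, so that a trace that is linear in
  \<^term>\<open>Y\<close> is the pairing of \<^term>\<open>Y\<close> with a mixed trace polynomial.\<close>

lemma contraction_mixed_trace:
  fixes A :: "('a::field, 'n::finite) mat set" and w :: "'i \<Rightarrow> 'k"
  assumes A: "unital_subalgebra A" and I: "finite I" "d \<in> I" and \<tau>: "\<tau> permutes I"
    and a: "\<And>i. i \<in> I \<Longrightarrow> a i \<in> A"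
  shows "\<exists>h\<in>mixed_trace_polys A. \<forall>X Y.
    contraction I (\<lambda>i. a i ** (if \<tau> i = d then Y else X (w (\<tau> i)))) \<tau> = trace (h X ** Y)"
proof -
  \<comment> \<open>\<open>e\<close> is the position whose factor contains \<open>Y\<close>; the
    distinguished matrix there is \<open>a e ** Y\<close>. Rotating the trace moves the remaining
    word in front of it, and \<open>a e\<close> becomes the final coefficient of the mixed trace
    polynomial.\<close>
  define e where "e = inv \<tau> d"
  have e: "\<tau> e = d" "e \<in> I"
    using permutes_inverses(1)[OF \<tau>] permutes_in_image[OF permutes_inv[OF \<tau>]] I(2)
    by (simp_all add: e_def)
  have e_iff: "\<tau> i = d \<longleftrightarrow> i = e" for i
    using e(1) permutes_inj[OF \<tau>] by (auto dest: injD)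
  define J where "J = I - {e}"
  have J: "finite J" "e \<notin> J" "insert e J = I" using I(1) e(2) by (auto simp: J_def)
  define ps where "ps i = [(a i, w (\<tau> i))]" for i
  have "set (ps i) \<subseteq> A \<times> UNIV" if "i \<in> J" for i using a that by (simp add: ps_def J_def)
  then obtain t qs where t: "t \<in> trace_funs A" and qs: "set qs \<subseteq> A \<times> UNIV"
    and eq: "\<And>X Z. contraction I (\<lambda>i. if i = e then Z else wordA (ps i) X) \<tau>
      = t X * trace (Z ** wordA qs X)"
    using contraction_words[of J e \<tau> ps A] J \<tau> by auto
  have "contraction I (\<lambda>i. a i ** (if \<tau> i = d then Y else X (w (\<tau> i)))) \<tau>
      = trace (msmult (t X) (wordA qs X ** a e) ** Y)" for X Y
  proof -
    have "contraction I (\<lambda>i. a i ** (if \<tau> i = d then Y else X (w (\<tau> i)))) \<tau>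
        = contraction I (\<lambda>i. if i = e then a e ** Y else wordA (ps i) X) \<tau>"
      by (intro contraction_cong) (auto simp: e_iff ps_def)
    also have "\<dots> = t X * trace (wordA qs X ** (a e ** Y))"
      by (simp add: eq trace_mul_sym[of "wordA qs X"])
    finally show ?thesis by (simp add: trace_msmult matrix_mul_assoc)
  qed
  moreover have "(\<lambda>X. msmult (t X) (wordA qs X ** a e)) \<in> mixed_trace_polys A"
    using t qs a[OF e(2)] by (rule mixed_trace_polys.mtp_term)
  ultimately show ?thesis
    by (intro bexI[of _ "\<lambda>X. msmult (t X) (wordA qs X ** a e)"]) auto
qed

text \<open>Here \<^term>\<open>H\<close> is the polarization of \<^term>\<open>f\<close>, and inserting the variables \<^term>\<open>X (w i)\<close>
  through \<open>\<iota>\<close> splits it according to the multidegrees.\<close>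

lemma homogeneous_equivariant:
  fixes A :: "('a::field_char_0, 'n::finite) mat set"
    and f :: "('k::finite \<Rightarrow> ('a, 'n) mat) \<Rightarrow> ('a, 'n) mat" and d :: nat
  assumes ss: "semisimple_subalgebra A"
    and f: "\<And>X p q. f X $ p $ q = (\<Sum>l\<in>S p q. c p q l * (\<Prod>i<d. entry (z p q l i) X))"
    and equi: "\<And>g X. g \<in> centralizer_units A \<Longrightarrow>
           f (\<lambda>i. g ** X i ** matrix_inv g) = g ** f X ** matrix_inv g"
  shows "f \<in> mixed_trace_polys A"
proof -
  have A: "unital_subalgebra A" using ss by (simp add: semisimple_subalgebra_def)
  define D where "D = {..<d}"
  let ?I = "insert d D"
  have D: "finite D" "d \<notin> D" by (auto simp: D_def)
  define H :: "(nat \<Rightarrow> 'k \<Rightarrow> ('a, 'n) mat) \<Rightarrow> ('a, 'n) mat" where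
    "H Xs = (\<chi> p q. \<Sum>\<sigma> | \<sigma> permutes D. \<Sum>l\<in>S p q. c p q l * (\<Prod>i\<in>D. entry (z p q l i) (Xs (\<sigma> i))))" for Xs
  \<comment> \<open>The monomials chosen for \<open>f\<close> are not individually equivariant.
    Writing \<open>H\<close> through values of \<open>f\<close> alone lets equivariance pass to
    \<open>H\<close>.\<close>
  have H_polar: "H Xs = (\<Sum>U\<in>Pow D. msmult ((-1) ^ (card D - card U)) (f (\<lambda>k. \<Sum>j\<in>U. Xs j k)))" for Xs
  proof -
    have "H Xs $ p $ q = (\<Sum>U\<in>Pow D. (-1) ^ (card D - card U) * f (\<lambda>k. \<Sum>j\<in>U. Xs j k) $ p $ q)" for p q
    proof -
      have perm: "(\<Sum>\<sigma> | \<sigma> permutes D. \<Prod>i\<in>D. entry (z p q l i) (Xs (\<sigma> i)))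
          = (\<Sum>U\<in>Pow D. (-1) ^ (card D - card U) * (\<Prod>i\<in>D. \<Sum>j\<in>U. entry (z p q l i) (Xs j)))" for l
        using permanent_polarization[OF D(1), of "\<lambda>i j. entry (z p q l i) (Xs j)"] .
      have "H Xs $ p $ q = (\<Sum>l\<in>S p q. c p q l * (\<Sum>\<sigma> | \<sigma> permutes D. \<Prod>i\<in>D. entry (z p q l i) (Xs (\<sigma> i))))"
        by (simp add: H_def sum_distrib_left) (rule sum.swap)
      also have "\<dots> = (\<Sum>l\<in>S p q. \<Sum>U\<in>Pow D. (-1) ^ (card D - card U) *
          (c p q l * (\<Prod>i\<in>D. \<Sum>j\<in>U. entry (z p q l i) (Xs j))))"
        by (simp add: perm sum_distrib_left mult.left_commute)
      also have "\<dots> = (\<Sum>U\<in>Pow D. (-1) ^ (card D - card U) *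
          (\<Sum>l\<in>S p q. c p q l * (\<Prod>i\<in>D. \<Sum>j\<in>U. entry (z p q l i) (Xs j))))"
        by (subst sum.swap) (simp add: sum_distrib_left)
      finally show ?thesis by (simp add: f entry_def sum_component D_def)
    qed
    then show ?thesis by (simp add: mat_eq_iff sum_component)
  qed
  have H_equi: "H (\<lambda>j k. g ** Xs j k ** matrix_inv g) = g ** H Xs ** matrix_inv g"
    if "g \<in> centralizer_units A" for g Xs
  proof -
    have "f (\<lambda>k. \<Sum>j\<in>U. g ** Xs j k ** matrix_inv g) = g ** f (\<lambda>k. \<Sum>j\<in>U. Xs j k) ** matrix_inv g" for U
      using equi[OF that, of "\<lambda>k. \<Sum>j\<in>U. Xs j k"]
      by (simp add: matrix_sum_ldistrib matrix_sum_rdistrib)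
    then show ?thesis by (simp add: H_polar matrix_sum_ldistrib matrix_sum_rdistrib)
  qed
  have H_diag: "H (\<lambda>j. X) = msmult (fact d) (f X)" for X
    using D(1) by (simp add: mat_eq_iff H_def f card_permutations[OF refl D(1)] flip: D_def)
       (simp add: D_def)
  define \<iota> :: "(nat \<Rightarrow> 'k) \<Rightarrow> (nat \<Rightarrow> ('a, 'n) mat) \<Rightarrow> nat \<Rightarrow> 'k \<Rightarrow> ('a, 'n) mat" where
    "\<iota> w M j k = (if k = w j then M j else 0)" for w M j k
  have entry_\<iota>: "entry z (\<iota> w M j) = (if fst z = w j then M j $ fst (snd z) $ snd (snd z) else 0)" for z w M j
    by (simp add: entry_def \<iota>_def)
  \<comment> \<open>The index \<open>d\<close> lies just outside \<open>D\<close> and serves as the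
    slot for the matrix that is paired with the value of \<open>H\<close>.\<close>
  define F where "F w M = trace (H (\<iota> w M) ** M d)" for w M
  have F_inv: "F w (\<lambda>i. g ** M i ** matrix_inv g) = F w M" if g: "g \<in> centralizer_units A" for w g M
  proof -
    have "invertible g" using g by (simp add: centralizer_units_def)
    note gg = matrix_inv_mult[OF this]
    have "\<iota> w (\<lambda>i. g ** M i ** matrix_inv g) = (\<lambda>j k. g ** \<iota> w M j k ** matrix_inv g)"
      by (auto simp: \<iota>_def fun_eq_iff)
    then have "F w (\<lambda>i. g ** M i ** matrix_inv g)
        = trace (g ** (H (\<iota> w M) ** ((matrix_inv g ** g) ** M d ** matrix_inv g)))"
      by (simp add: F_def H_equi[OF g] matrix_mul_assoc)
    also have "\<dots> = trace ((H (\<iota> w M) ** (M d ** matrix_inv g)) ** g)"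
      by (simp add: gg(2) trace_mul_sym[of g])
    also have "\<dots> = F w M"
      by (simp add: F_def gg(2) flip: matrix_mul_assoc)
    finally show ?thesis .
  qed
  have F_multi: "multilinear_form ?I (F w)" for w
  proof -
    \<comment> \<open>A monomial survives \<open>\<iota>\<close> only if the variable of each of its
      coordinates is the one that \<open>w\<close> assigns to the slot filling it. In that case each
      slot contributes exactly one matrix entry.\<close>
    have monomial: "multilinear_form ?I (\<lambda>M. (\<Prod>i\<in>D. entry (y i) (\<iota> w M (\<sigma> i))) * M d $ q $ p)"
      if \<sigma>: "\<sigma> permutes D" for \<sigma> y p q
    proof (cases "\<forall>i\<in>D. fst (y i) = w (\<sigma> i)")
      case True
      let ?r = "\<lambda>i. if i = d then q else fst (snd (y (inv \<sigma> i)))"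
      let ?s = "\<lambda>i. if i = d then p else snd (snd (y (inv \<sigma> i)))"
      have "(\<Prod>i\<in>D. entry (y i) (\<iota> w M (\<sigma> i))) * M d $ q $ p = (\<Prod>i\<in>?I. M i $ ?r i $ ?s i)" for M
      proof -
        have "(\<Prod>i\<in>D. entry (y i) (\<iota> w M (\<sigma> i))) = (\<Prod>i\<in>D. M (\<sigma> i) $ fst (snd (y i)) $ snd (snd (y i)))"
          using True by (simp add: entry_\<iota>)
        also have "\<dots> = (\<Prod>i\<in>D. M i $ fst (snd (y (inv \<sigma> i))) $ snd (snd (y (inv \<sigma> i))))"
          using prod.permute[OF \<sigma>, of "\<lambda>i. M i $ fst (snd (y (inv \<sigma> i))) $ snd (snd (y (inv \<sigma> i)))"]
          by (simp add: comp_def permutes_inverses[OF \<sigma>])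
        also have "\<dots> = (\<Prod>i\<in>D. M i $ ?r i $ ?s i)" using D by (intro prod.cong refl) auto
        finally show ?thesis using D by (simp add: mult.commute)
      qed
      then show ?thesis using multilinear_form_monomial[of ?I ?r ?s] D(1) by simp
    next
      case False
      then have "(\<Prod>i\<in>D. entry (y i) (\<iota> w M (\<sigma> i))) = 0" for M
        using D(1) by (intro prod_zero) (auto simp: entry_\<iota>)
      then show ?thesis by (simp add: multilinear_form_zero)
    qed
    have "F w = (\<lambda>M. \<Sum>p\<in>UNIV. \<Sum>q\<in>UNIV. \<Sum>\<sigma> | \<sigma> permutes D. \<Sum>l\<in>S p q.
        c p q l * ((\<Prod>i\<in>D. entry (z p q l i) (\<iota> w M (\<sigma> i))) * M d $ q $ p))"
      by (simp add: F_def fun_eq_iff trace_def matrix_mult_nth H_def sum_distrib_right mult.assoc)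
    then show ?thesis
      by (auto intro!: multilinear_form_sum multilinear_form_scale monomial)
  qed
  have F_mixed: "\<exists>h\<in>mixed_trace_polys A. \<forall>X Y. F w (\<lambda>i. if i = d then Y else X (w i)) = trace (h X ** Y)" for w
  proof -
    obtain T where T: "\<And>M. F w M = (\<Sum>x\<in>?I \<rightarrow>\<^sub>E UNIV. \<Sum>y\<in>?I \<rightarrow>\<^sub>E UNIV. T x y * (\<Prod>i\<in>?I. M i $ y i $ x i))"
      using F_multi unfolding multilinear_form_def by blast
    obtain R :: "(((nat \<Rightarrow> nat) \<times> (nat \<Rightarrow> ('a, 'n) mat)) \<times> ((nat \<Rightarrow> nat) \<times> (nat \<Rightarrow> ('a, 'n) mat))) set"
      and \<beta> a \<tau> where R: "finite R" "\<And>r. r \<in> R \<Longrightarrow> \<tau> r permutes ?I"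
        "\<And>r i. r \<in> R \<Longrightarrow> i \<in> ?I \<Longrightarrow> a r i \<in> A"
      and F_eq: "\<And>M. F w M = (\<Sum>r\<in>R. \<beta> r * contraction ?I (\<lambda>i. a r i ** M (\<tau> r i)) (\<tau> r))"
      by (rule multilinear_invariant[OF ss finite.insertI[OF D(1)] T F_inv], assumption+, rule that)
    have "\<exists>h. \<forall>r\<in>R. h r \<in> mixed_trace_polys A \<and> (\<forall>X Y.
        contraction ?I (\<lambda>i. a r i ** (if \<tau> r i = d then Y else X (w (\<tau> r i)))) (\<tau> r) = trace (h r X ** Y))"
    proof (rule bchoice, rule ballI)
      fix r assume r: "r \<in> R"
      show "\<exists>h. h \<in> mixed_trace_polys A \<and> (\<forall>X Y.
          contraction ?I (\<lambda>i. a r i ** (if \<tau> r i = d then Y else X (w (\<tau> r i)))) (\<tau> r) = trace (h X ** Y))"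
        using contraction_mixed_trace[OF A finite.insertI[OF D(1)] insertI1 R(2)[OF r] R(3)[OF r], where w = w]
        by (simp only: Bex_def)
    qed
    then obtain h where h: "\<And>r. r \<in> R \<Longrightarrow> h r \<in> mixed_trace_polys A"
      and h_eq: "\<And>r X Y. r \<in> R \<Longrightarrow> contraction ?I (\<lambda>i. a r i ** (if \<tau> r i = d then Y else X (w (\<tau> r i)))) (\<tau> r)
        = trace (h r X ** Y)" by blast
    have "F w (\<lambda>i. if i = d then Y else X (w i)) = trace ((\<Sum>r\<in>R. msmult (\<beta> r) (h r X)) ** Y)" for X Y
      by (simp add: F_eq h_eq matrix_sum_rdistrib trace_sum trace_msmult)
    moreover have "(\<lambda>X. \<Sum>r\<in>R. msmult (\<beta> r) (h r X)) \<in> mixed_trace_polys A"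
      using h by (intro mixed_trace_polys_sum mixed_trace_polys_scale)
    ultimately show ?thesis
      by (intro bexI[of _ "\<lambda>X. \<Sum>r\<in>R. msmult (\<beta> r) (h r X)"]) auto
  qed
  then obtain h where h: "\<And>w. h w \<in> mixed_trace_polys A"
    and h_eq: "\<And>w X Y. F w (\<lambda>i. if i = d then Y else X (w i)) = trace (h w X ** Y)"
    by metis
  let ?W = "D \<rightarrow>\<^sub>E (UNIV :: 'k set)"
  \<comment> \<open>In every slot the tuple \<open>X\<close> is the sum, over the variables
    \<open>k\<close>, of the tuple that keeps only the component \<open>X k\<close>. Multilinearity
    of \<open>H\<close> expands this into one term for each assignment \<open>w\<close> of variables
    to slots.\<close>
  have H_sum: "H (\<lambda>j. X) = (\<Sum>w\<in>?W. H (\<iota> w (\<lambda>i. X (w i))))" for X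
  proof -
    have split: "(\<Prod>i\<in>D. entry (y i) X) = (\<Sum>w\<in>?W. \<Prod>i\<in>D. entry (y i) (\<iota> w (\<lambda>i. X (w i)) (\<sigma> i)))"
      if \<sigma>: "\<sigma> permutes D" for \<sigma> y
    proof -
      let ?e = "\<lambda>i k. if fst (y i) = k then entry (y i) X else 0"
      have "(\<Prod>i\<in>D. entry (y i) (\<iota> w (\<lambda>i. X (w i)) (\<sigma> i))) = (\<Prod>i\<in>D. ?e (inv \<sigma> i) (w i))" for w
      proof -
        have "(\<Prod>i\<in>D. entry (y i) (\<iota> w (\<lambda>i. X (w i)) (\<sigma> i))) = (\<Prod>i\<in>D. ?e i (w (\<sigma> i)))"
          by (intro prod.cong refl) (auto simp: entry_def \<iota>_def)
        also have "\<dots> = (\<Prod>i\<in>D. ?e (inv \<sigma> i) (w i))"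
          using prod.permute[OF \<sigma>, of "\<lambda>i. ?e (inv \<sigma> i) (w i)"]
          by (simp add: comp_def permutes_inverses[OF \<sigma>] cong: if_cong)
        finally show ?thesis .
      qed
      then have "(\<Sum>w\<in>?W. \<Prod>i\<in>D. entry (y i) (\<iota> w (\<lambda>i. X (w i)) (\<sigma> i)))
          = (\<Prod>i\<in>D. \<Sum>k\<in>UNIV. ?e (inv \<sigma> i) k)"
        using D(1) by (simp add: prod_sum_PiE del: sum.delta sum.delta')
      also have "\<dots> = (\<Prod>i\<in>D. entry (y (inv \<sigma> i)) X)" by simp
      also have "\<dots> = (\<Prod>i\<in>D. entry (y i) X)"
        using prod.permute[OF permutes_inv[OF \<sigma>], of "\<lambda>i. entry (y i) X"] by (simp add: comp_def)
      finally show ?thesis by simp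
    qed
    have "H (\<lambda>j. X) $ p $ q = (\<Sum>w\<in>?W. H (\<iota> w (\<lambda>i. X (w i))) $ p $ q)" for p q
    proof -
      have "H (\<lambda>j. X) $ p $ q = (\<Sum>\<sigma> | \<sigma> permutes D. \<Sum>l\<in>S p q. \<Sum>w\<in>?W.
          c p q l * (\<Prod>i\<in>D. entry (z p q l i) (\<iota> w (\<lambda>i. X (w i)) (\<sigma> i))))"
        unfolding H_def by (simp add: sum_distrib_left[symmetric] split[symmetric])
      also have "\<dots> = (\<Sum>w\<in>?W. \<Sum>\<sigma> | \<sigma> permutes D. \<Sum>l\<in>S p q.
          c p q l * (\<Prod>i\<in>D. entry (z p q l i) (\<iota> w (\<lambda>i. X (w i)) (\<sigma> i))))"
        by (simp only: sum.swap[where B = ?W])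
      finally show ?thesis by (simp add: H_def)
    qed
    then show ?thesis by (simp add: mat_eq_iff sum_component)
  qed
  \<comment> \<open>On a constant family every permutation contributes the same term, so
    \<open>H\<close> equals \<open>fact d\<close> times \<open>f\<close> there; this is the origin
    of the scalar.\<close>
  have "f X = (\<Sum>w\<in>?W. msmult (inverse (fact d)) (h w X))" for X
  proof (rule trace_eqI)
    fix Y
    have F_eq: "F w (\<lambda>i. if i = d then Y else X (w i)) = trace (H (\<iota> w (\<lambda>i. X (w i))) ** Y)" for w
    proof -
      have "H (\<iota> w (\<lambda>i. if i = d then Y else X (w i))) = H (\<iota> w (\<lambda>i. X (w i)))"
      proof -
        have "\<sigma> i \<noteq> d" if "\<sigma> permutes D" "i \<in> D" for \<sigma> i
          using permutes_in_image[OF that(1), of i] that(2) D(2) by metis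
        then have "entry y (\<iota> w (\<lambda>i. if i = d then Y else X (w i)) (\<sigma> i)) = entry y (\<iota> w (\<lambda>i. X (w i)) (\<sigma> i))"
          if "\<sigma> permutes D" "i \<in> D" for \<sigma> i y
          using that by (simp add: entry_\<iota>)
        then show ?thesis by (simp add: H_def mat_eq_iff)
      qed
      then show ?thesis by (simp add: F_def)
    qed
    have "fact d * trace (f X ** Y) = trace (H (\<lambda>j. X) ** Y)"
      by (simp add: H_diag trace_msmult)
    also have "\<dots> = (\<Sum>w\<in>?W. trace (h w X ** Y))"
      by (simp add: H_sum matrix_sum_rdistrib trace_sum flip: F_eq h_eq)
    also have "\<dots> = fact d * trace ((\<Sum>w\<in>?W. msmult (inverse (fact d)) (h w X)) ** Y)"
      by (simp add: matrix_sum_rdistrib trace_sum trace_msmult flip: sum_distrib_left)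
    finally show "trace (f X ** Y) = trace ((\<Sum>w\<in>?W. msmult (inverse (fact d)) (h w X)) ** Y)"
      by simp
  qed
  then have "f = (\<lambda>X. \<Sum>w\<in>?W. msmult (inverse (fact d)) (h w X))" by (rule ext)
  then show ?thesis
    using h by (simp add: mixed_trace_polys_sum mixed_trace_polys_scale)
qed

section \<open>Reduction to homogeneous components\<close>

lemma power_sum_coeff_zero:
  fixes e :: "nat \<Rightarrow> 'a::field_char_0"
  assumes K: "finite K" and zero: "\<And>t. (\<Sum>d\<in>K. t ^ d * e d) = 0" and d: "d \<in> K"
  shows "e d = 0"
proof -
  define p where "p = (\<Sum>d\<in>K. monom (e d) d)"
  have "poly p t = 0" for t using zero by (simp add: p_def poly_sum poly_monom mult.commute)
  then have "p = 0" using poly_all_0_iff_0 by blast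
  moreover have "coeff p d = e d" using K d by (simp add: p_def coeff_sum)
  ultimately show ?thesis by simp
qed

theorem theorem5p10:
  fixes A :: "('a::field_char_0, 'n::finite) mat set"
    and f :: "('k::finite \<Rightarrow> ('a, 'n) mat) \<Rightarrow> ('a, 'n) mat"
  assumes "semisimple_subalgebra A"
    and "polynomial_map f"
    and "\<And>g X. g \<in> centralizer_units A \<Longrightarrow>
           f (\<lambda>i. g ** X i ** matrix_inv g) = g ** f X ** matrix_inv g"
  shows "f \<in> mixed_trace_polys A"
proof -
  have "\<forall>p q. \<exists>L. \<forall>X. f X $ p $ q = (\<Sum>(c, zs)\<leftarrow>L. c * (\<Prod>z\<leftarrow>zs. entry z X))"
    using assms(2) poly_funs_monomials unfolding polynomial_map_def by blast
  then obtain L where L: "\<And>p q X. f X $ p $ q = (\<Sum>(c, zs)\<leftarrow>L p q. c * (\<Prod>z\<leftarrow>zs. entry z X))"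
    by metis
  define c where "c p q l = fst (L p q ! l)" for p q l
  define m where "m p q l = length (snd (L p q ! l))" for p q l
  define z where "z p q l i = snd (L p q ! l) ! i" for p q l i
  define S where "S d p q = {l. l < length (L p q) \<and> m p q l = d}" for d p q
  define K where "K = (\<Union>p. \<Union>q. m p q ` {..<length (L p q)})"
  have K: "finite K" by (simp add: K_def)
  \<comment> \<open>In every entry the monomials of length \<open>d\<close> are collected; an entry
    without such monomials is zero, so one index set \<open>K\<close> of degrees serves all
    entries.\<close>
  define F where "F d X = (\<chi> p q. \<Sum>l\<in>S d p q. c p q l * (\<Prod>i<d. entry (z p q l i) X))"
    for d and X :: "'k \<Rightarrow> ('a, 'n) mat"
  have f_sum: "f X = (\<Sum>d\<in>K. F d X)" for X
  proof -
    have "f X $ p $ q = (\<Sum>d\<in>K. F d X $ p $ q)" for p q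
    proof -
      have "f X $ p $ q = (\<Sum>l<length (L p q). c p q l * (\<Prod>i<m p q l. entry (z p q l i) X))"
        unfolding L c_def m_def z_def
        by (simp add: sum.list_conv_set_nth prod.list_conv_set_nth case_prod_unfold atLeast0LessThan)
      also have "\<dots> = (\<Sum>d\<in>K. \<Sum>l | l \<in> {..<length (L p q)} \<and> m p q l = d.
          c p q l * (\<Prod>i<m p q l. entry (z p q l i) X))"
        using K by (intro sum.group[symmetric]) (auto simp: K_def)
      also have "\<dots> = (\<Sum>d\<in>K. F d X $ p $ q)"
        by (auto simp: F_def S_def intro!: sum.cong)
      finally show ?thesis .
    qed
    then show ?thesis by (simp add: mat_eq_iff sum_component)
  qed
  have F_scale: "F d (\<lambda>k. msmult t (X k)) = msmult (t ^ d) (F d X)" for d t X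
    by (simp add: mat_eq_iff F_def entry_def prod.distrib sum_distrib_left mult_ac)
  \<comment> \<open>Scaling \<open>X\<close> by \<open>t\<close> turns the equivariance of
    \<open>f\<close> into an identity between polynomials in \<open>t\<close>. Comparing the
    coefficients of \<open>t ^ d\<close> gives the equivariance of each component.\<close>
  have F_equi: "F d (\<lambda>i. g ** X i ** matrix_inv g) = g ** F d X ** matrix_inv g"
    if g: "g \<in> centralizer_units A" and d: "d \<in> K" for d g X
  proof -
    let ?e = "\<lambda>d. F d (\<lambda>i. g ** X i ** matrix_inv g) - g ** F d X ** matrix_inv g"
    have "(\<Sum>d\<in>K. t ^ d * (?e d $ p $ q)) = 0" for t p q
    proof -
      have "(\<Sum>d\<in>K. msmult (t ^ d) (F d (\<lambda>i. g ** X i ** matrix_inv g)))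
          = (\<Sum>d\<in>K. msmult (t ^ d) (g ** F d X ** matrix_inv g))"
        using assms(3)[OF g, of "\<lambda>k. msmult t (X k)"]
        by (simp add: f_sum F_scale matrix_sum_ldistrib matrix_sum_rdistrib)
      then have "(\<Sum>d\<in>K. msmult (t ^ d) (?e d)) $ p $ q = 0"
        by (simp add: mat_vs.scale_right_diff_distrib sum_subtractf)
      then show ?thesis by (simp add: sum_component)
    qed
    then have "?e d $ p $ q = 0" for p q
      using power_sum_coeff_zero[OF K _ d, of "\<lambda>d. ?e d $ p $ q"] by blast
    then show ?thesis by (simp add: mat_eq_iff)
  qed
  have "F d \<in> mixed_trace_polys A" if d: "d \<in> K" for d
  proof (rule homogeneous_equivariant[OF assms(1)])
    show "F d X $ p $ q = (\<Sum>l\<in>S d p q. c p q l * (\<Prod>i<d. entry (z p q l i) X))" for X p q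
      by (simp add: F_def)
  qed (rule F_equi[OF _ d])
  then have "(\<lambda>X. \<Sum>d\<in>K. F d X) \<in> mixed_trace_polys A"
    by (rule mixed_trace_polys_sum)
  then show ?thesis by (simp flip: f_sum)
qed

end
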